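(* Let $R>0$ and let $\tau\in(0,T)$ be arbitrary. Let $g^*$ be the exact data and assume that the exact solution $v^*$, i.e. a function satisfying $$v^*_t=Lv^*+Lg^*+F(\nabla v^*+\nabla g^*,v^*+g^*,x,t)\ \text{ in }Q_T,\qquad v^*|_{S_T}=0,\qquad v^*(x,T)=0,\ x\in\Omega,$$ belongs to $B(R)$. For $\delta\in(0,1)$ set $$\nu(\delta)=\ln\left[\left(\ln(\delta^{-1/2})\right)^{1/\ln(T+1)}\right].$$ Let $\nu_3>1$ and $C_2>0$ be the numbers of the strict convexity property described in the context, and let $\delta_0=\delta_0(\mu_1,\mu_2,\max_{i,j}\|a_{ij}\|_{C^1(\overline{Q}_T)},\|g^*\|_{C^2(\overline{\Omega})},Q_T,R,\overline{C})\in(0,1)$ be so small that $$\nu(\delta_0)\ge\nu_3\quad\text{and}\quad 2C_2\exp\left(-2(\tau+1)^{\nu(\delta_0)}\right)\in(0,1).$$ Let $\delta\in(0,\delta_0)$, let the noisy data $g$ satisfy $\|g-g^*\|_{C^2(\overline{\Omega})}<\delta$, and set $\nu=\nu(\delta)$ and $$\alpha=\alpha(\delta)=2C_2\exp\left(-2(\tau+1)^{\nu(\delta)}\right).$$ Let $v_{\min}\in\overline{B(R)}$ be the unique minimizer on $\overline{B(R)}$ of the functional $I_{\alpha,\nu}$ (built from $g$). Let $\gamma_0\in(0,1)$, $\gamma\in(0,\gamma_0)$, $\theta=\theta(\gamma)\in(0,1)$ be the numbers of the gradient projection convergence property described in the context, let $v_0\in B(R)$ be arbitrary, and let $v_n=P_{\overline{B}}\left(v_{n-1}-\gamma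 I_{\alpha,\nu}'(v_{n-1})\right)$, $n=1,2,\dots$. Then there is a constant $\widetilde{C}_2>0$, depending only on $\mu_1,\mu_2,\max_{i,j}\|a_{ij}\|_{C^1(\overline{Q}_T)},\|g^*\|_{C^2(\overline{\Omega})},Q_T,R,\overline{C}$, such that $$\|v^*-v_{\min}\|_{H^{1,0}(Q_{T\tau})}\le\widetilde{C}_2\exp\left[-\frac{1}{2^{c}}\left(\ln(\delta^{-1})\right)^{c}\right],$$ $$\|v^*-v_n\|_{H^{1,0}(Q_{T\tau})}\le\widetilde{C}_2\exp\left[-\frac{1}{2^{c}}\left(\ln(\delta^{-1})\right)^{c}\right]+\theta^n\|v_{\min}-v_0\|_{H^k(Q_T)},\quad n=1,2,\dots,$$ where $c=c(\tau,T)=\ln(\tau+1)/\ln(T+1)\in(0,1)$.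
   Context: All functions are real valued. $\Omega\subset\mathbb{R}^n$ is a bounded domain with piecewise smooth boundary $\partial\Omega$, $T>0$, $Q_T=\Omega\times(0,T)$, $S_T=\partial\Omega\times(0,T)$, and $Q_{T\tau}=\Omega\times(\tau,T)$ for $\tau\in(0,T)$. $\nabla$ is the gradient in $x$ only. The functions $a_{ij}$, $i,j=1,\dots,n$, satisfy $a_{ij}=a_{ji}\in C^1(\overline{Q}_T)$ and, for constants $0<\mu_1\le\mu_2$, $\mu_1|\xi|^2\le\sum_{i,j=1}^n a_{ij}(x,t)\xi_i\xi_j\le\mu_2|\xi|^2$ for all $(x,t)\in\overline{Q}_T$, $\xi\in\mathbb{R}^n$. The operator $L$ is $Lu=\sum_{i,j=1}^n a_{ij}(x,t)u_{x_ix_j}$. The function $F\in C^1(\mathbb{R}^{2n+2})$ satisfies, with a constant $\overline{C}=\overline{C}(F)>0$, $|F(y_1)-F(y_2)|\le\overline{C}|y_1-y_2|$ for all $y_1,y_2\in\mathbb{R}^{2n+2}$. The data $g,g^*\in C^2(\overline{\Omega})$ vanish on $\partial\Omega$. $k$ is an integer with $k>[(n+1)/2]+2$ ($[\cdot]$ the integer part), so that $H^k(Q_T)\subset C^2(\overline{Q}_T)$ with continuous embedding. $H_0^k(Q_T)=\{v\in H^k(Q_T): v|_{S_T}=0,\ v(x,T)=0\}$, and $B(R)=\{v\in H_0^k(Q_T):\|v\|_{H^k(Q_T)}<R\}$, with closure $\overline{B(R)}$. $H^{1,0}(Q_{T\tau})$ has norm $\|u\|_{H^{1,0}(Q_{T\tau})}=\left[\int_{Q_{T\tau}}\left((\nabla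 u)^2+u^2\right)dx\,dt\right]^{1/2}$. $P_{\overline{B}}:H_0^k(Q_T)\to\overline{B(R)}$ is the orthogonal projection operator of $H_0^k(Q_T)$ onto the closed ball $\overline{B(R)}$. With $G(\nabla v,v,x,t)=Lg+F(\nabla v+\nabla g,v+g,x,t)$, the weighted Tikhonov-like functional is $$I_{\alpha,\nu}(v)=\exp\left(-2(\tau+1)^{\nu}\right)\int_{Q_T}\left(v_t-Lv-G(\nabla v,v,x,t)\right)^2\exp\left(2(t+1)^{\nu}\right)dx\,dt+\alpha\|v\|_{H^k(Q_T)}^2,$$ with Fréchet derivative $I_{\alpha,\nu}'(v)\in H_0^k(Q_T)$ (identified with an element of the Hilbert space via the Riesz theorem). Strict convexity property: $\nu_3>1$ and $C_2>0$ are numbers depending only on $\mu_1,\mu_2,\max_{i,j}\|a_{ij}\|_{C^1(\overline{Q}_T)},\|g^*\|_{C^2(\overline{\Omega})},Q_T,R,\overline{C}$ (dependence on $\|g\|_{C^2(\overline{\Omega})}$ is replaced by dependence on $\|g^*\|_{C^2(\overline{\Omega})}$, since $\|g-g^*\|_{C^2(\overline{\Omega})}<\delta<1$) such that for all $\nu\ge\nu_3$ one has $2C_2\exp(-2(\tau+1)^{\nu})\in(0,1)$, and for all $\alpha\in[2C_2\exp(-2(\tau+1)^{\nu}),1)$ and all $v_1,v_2\in\overline{B(R)}$, $$I_{\alpha,\nu}(v_2)-I_{\alpha,\nu}(v_1)-I_{\alpha,\nu}'(v_1)(v_2-v_1)\ge C_2\|v_2-v_1\|_{H^{1,0}(Q_{T\tau})}^2+\frac{\alpha}{2}\|v_2-v_1\|_{H^k(Q_T)}^2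 .$$ For such $\nu,\alpha$ the functional $I_{\alpha,\nu}$ has a unique minimizer $v_{\min}$ on $\overline{B(R)}$. Gradient projection convergence property: $\gamma_0\in(0,1)$ (depending on $\mu_1,\mu_2,\max_{i,j}\|a_{ij}\|_{C^1(\overline{Q}_T)},\|g^*\|_{C^2(\overline{\Omega})},Q_T,R,\overline{C},\nu,\alpha$) is a number such that for every $\gamma\in(0,\gamma_0)$ there exists $\theta=\theta(\gamma)\in(0,1)$ for which the sequence $v_n=P_{\overline{B}}(v_{n-1}-\gamma I_{\alpha,\nu}'(v_{n-1}))$ started at any $v_0\in B(R)$ satisfies $\|v_n-v_{\min}\|_{H^k(Q_T)}\le\theta^n\|v_{\min}-v_0\|_{H^k(Q_T)}$ for all $n\ge1$. *)

theory Defs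
  imports "HOL-Analysis.Analysis" "HOL-Library.Multiset"
begin

text \<open>
  Points of space-time are pairs \<open>(x, t)\<close> of type \<open>(real^'n) \<times> real\<close>; this is a Euclidean space
  of dimension \<open>CARD('n) + 1\<close>, whose basis consists of the \<open>n\<close> space directions and of the time
  direction.
\<close>

section \<open>Classical derivatives and the spaces \<open>C\<^sup>m\<close>\<close>

definition partial :: "'a::euclidean_space \<Rightarrow> ('a \<Rightarrow> real) \<Rightarrow> 'a \<Rightarrow> real" where
  "partial b u z = deriv (\<lambda>s::real. u (z + s *\<^sub>R b)) 0"

fun iter_partial :: "'a::euclidean_space list \<Rightarrow> ('a \<Rightarrow> real) \<Rightarrow> 'a \<Rightarrow> real" where
  "iter_partial [] u = u"
| "iter_partial (b # bs) u = partial b (iter_partial bs u)"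

definition C_open :: "nat \<Rightarrow> 'a::euclidean_space set \<Rightarrow> ('a \<Rightarrow> real) \<Rightarrow> bool" where
  "C_open m S u \<longleftrightarrow>
     (\<forall>bs. set bs \<subseteq> Basis \<and> length bs \<le> m \<longrightarrow> continuous_on S (iter_partial bs u)) \<and>
     (\<forall>bs. set bs \<subseteq> Basis \<and> length bs < m \<longrightarrow>
        (\<forall>b\<in>Basis. \<forall>z\<in>S. (\<lambda>s::real. iter_partial bs u (z + s *\<^sub>R b)) differentiable (at 0)))"

text \<open>\<open>u \<in> C\<^sup>m(closure S)\<close> for an open set \<open>S\<close>: the derivatives of order \<open>\<le> m\<close> in \<open>S\<close> extend
  continuously to the closure. The norm is the maximum over all derivatives of order \<open>\<le> m\<close> of
  their maximum, which is the supremum over \<open>S\<close>.\<close>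

definition C_closed :: "nat \<Rightarrow> 'a::euclidean_space set \<Rightarrow> ('a \<Rightarrow> real) \<Rightarrow> bool" where
  "C_closed m S u \<longleftrightarrow> C_open m S u \<and> continuous_on (closure S) u \<and>
     (\<forall>bs. set bs \<subseteq> Basis \<and> length bs \<le> m \<longrightarrow>
        (\<exists>w. continuous_on (closure S) w \<and> (\<forall>z\<in>S. w z = iter_partial bs u z)))"

definition C_norm :: "nat \<Rightarrow> 'a::euclidean_space set \<Rightarrow> ('a \<Rightarrow> real) \<Rightarrow> real" where
  "C_norm m S u = Sup {\<bar>iter_partial bs u z\<bar> | bs z. set bs \<subseteq> Basis \<and> length bs \<le> m \<and> z \<in> S}"


section \<open>Domains with piecewise smooth boundary\<close>

text \<open>``Smooth'' is read as \<open>C\<^sup>1\<close>, the weakest usual reading. Near a smooth boundary point the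
  domain lies on one side of a level set \<open>\<rho> = 0\<close> with \<open>\<nabla>\<rho> \<noteq> 0\<close>. The boundary is piecewise smooth
  if it is covered by the closures of finitely many connected, relatively open smooth pieces; edges,
  vertices and conical points are thus allowed.\<close>

definition smooth_boundary_point :: "'a::euclidean_space set \<Rightarrow> 'a \<Rightarrow> bool" where
  "smooth_boundary_point \<Omega> p \<longleftrightarrow> p \<in> frontier \<Omega> \<and>
     (\<exists>U \<rho>. open U \<and> p \<in> U \<and> C_open 1 U \<rho> \<and> (\<forall>x\<in>U. \<exists>b\<in>Basis. partial b \<rho> x \<noteq> 0) \<and>
        \<Omega> \<inter> U = {x \<in> U. \<rho> x < 0})"

definition piecewise_smooth_boundary :: "'a::euclidean_space set \<Rightarrow> bool" where
  "piecewise_smooth_boundary \<Omega> \<longleftrightarrow>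
     (\<exists>\<P>. finite \<P> \<and> frontier \<Omega> = (\<Union>\<Sigma>\<in>\<P>. closure \<Sigma>) \<and>
        (\<forall>\<Sigma>\<in>\<P>. connected \<Sigma> \<and> openin (top_of_set (frontier \<Omega>)) \<Sigma> \<and>
           (\<forall>p\<in>\<Sigma>. smooth_boundary_point \<Omega> p)))"

definition bounded_domain :: "'a::euclidean_space set \<Rightarrow> bool" where
  "bounded_domain \<Omega> \<longleftrightarrow> open \<Omega> \<and> connected \<Omega> \<and> \<Omega> \<noteq> {} \<and> bounded \<Omega> \<and> piecewise_smooth_boundary \<Omega>"


section \<open>Sobolev spaces\<close>

definition test_function :: "'a::euclidean_space set \<Rightarrow> ('a \<Rightarrow> real) \<Rightarrow> bool" where
  "test_function Q \<phi> \<longleftrightarrow> (\<forall>m. C_open m UNIV \<phi>) \<and>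
     compact (closure {z. \<phi> z \<noteq> 0}) \<and> closure {z. \<phi> z \<noteq> 0} \<subseteq> Q"

definition square_integrable :: "'a::euclidean_space set \<Rightarrow> ('a \<Rightarrow> real) \<Rightarrow> bool" where
  "square_integrable Q f \<longleftrightarrow>
     set_borel_measurable lborel Q f \<and> set_integrable lborel Q (\<lambda>z. (f z)\<^sup>2)"

text \<open>A multi-index is a multiset of basis vectors, its order is the size of the multiset.\<close>

definition multi_indices :: "nat \<Rightarrow> 'a::euclidean_space multiset set" where
  "multi_indices k = {\<beta>. set_mset \<beta> \<subseteq> Basis \<and> size \<beta> \<le> k}"

definition is_weak_deriv ::
  "'a::euclidean_space set \<Rightarrow> 'a multiset \<Rightarrow> ('a \<Rightarrow> real) \<Rightarrow> ('a \<Rightarrow> real) \<Rightarrow> bool" where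
  "is_weak_deriv Q \<beta> u f \<longleftrightarrow> square_integrable Q f \<and>
     (\<forall>\<phi> bs. test_function Q \<phi> \<and> mset bs = \<beta> \<longrightarrow>
        (LINT z:Q|lborel. u z * iter_partial bs \<phi> z) = (- 1) ^ size \<beta> * (LINT z:Q|lborel. f z * \<phi> z))"

text \<open>Weak derivatives are unique up to a null set, so that the choice below does not affect the
  integrals in which \<open>weak_deriv\<close> occurs.\<close>

definition weak_deriv :: "'a::euclidean_space set \<Rightarrow> 'a multiset \<Rightarrow> ('a \<Rightarrow> real) \<Rightarrow> 'a \<Rightarrow> real" where
  "weak_deriv Q \<beta> u = (SOME f. is_weak_deriv Q \<beta> u f)"

text \<open>The space \<open>H\<^sup>k(Q)\<close> for orders \<open>k\<close> exceeding half the dimension. By the Sobolev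
  embedding (part of the standing assumptions on the domain) every
  class of functions modulo null sets contains exactly one function that is continuous on the closure
  of \<open>Q\<close> and, by convention, \<open>0\<close> outside of it; this function represents the class. Hence equality of
  elements is equality of functions, and pointwise values, traces and (for \<open>k\<close> as in the theorem)
  classical derivatives up to order 2 make sense.\<close>

definition sobolev :: "nat \<Rightarrow> 'a::euclidean_space set \<Rightarrow> ('a \<Rightarrow> real) set" where
  "sobolev k Q = {u. continuous_on (closure Q) u \<and> (\<forall>z. z \<notin> closure Q \<longrightarrow> u z = 0) \<and>
     (\<forall>\<beta>\<in>multi_indices k. \<exists>f. is_weak_deriv Q \<beta> u f)}"

definition sobolev_inner ::
  "nat \<Rightarrow> 'a::euclidean_space set \<Rightarrow> ('a \<Rightarrow> real) \<Rightarrow> ('a \<Rightarrow> real) \<Rightarrow> real" where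
  "sobolev_inner k Q u w =
     (\<Sum>\<beta>\<in>multi_indices k. LINT z:Q|lborel. weak_deriv Q \<beta> u z * weak_deriv Q \<beta> w z)"

definition sobolev_norm :: "nat \<Rightarrow> 'a::euclidean_space set \<Rightarrow> ('a \<Rightarrow> real) \<Rightarrow> real" where
  "sobolev_norm k Q u = sqrt (sobolev_inner k Q u u)"


section \<open>Space-time notions\<close>

definition cylinder :: "'a set \<Rightarrow> real \<Rightarrow> real \<Rightarrow> ('a \<times> real) set" where
  "cylinder \<Omega> s T = \<Omega> \<times> {s<..<T}"

abbreviation QT :: "'a set \<Rightarrow> real \<Rightarrow> ('a \<times> real) set" where
  "QT \<Omega> T \<equiv> cylinder \<Omega> 0 T"

definition dir_x :: "'n::finite \<Rightarrow> (real^'n) \<times> real" where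
  "dir_x i = (axis i 1, 0)"

definition dir_t :: "(real^'n::finite) \<times> real" where
  "dir_t = (0, 1)"

definition grad_x :: "((real^'n::finite) \<times> real \<Rightarrow> real) \<Rightarrow> (real^'n) \<times> real \<Rightarrow> real^'n" where
  "grad_x u z = (\<chi> i. partial (dir_x i) u z)"

text \<open>The norm of \<open>H\<^sup>1\<^sup>,\<^sup>0(Q)\<close>, which involves (weak) derivatives in space only.\<close>

definition H10_norm ::
  "((real^'n::finite) \<times> real) set \<Rightarrow> ((real^'n) \<times> real \<Rightarrow> real) \<Rightarrow> real" where
  "H10_norm Q u =
     sqrt (LINT z:Q|lborel. (\<Sum>i\<in>UNIV. (weak_deriv Q {#dir_x i#} u z)\<^sup>2) + (u z)\<^sup>2)"

definition H0 :: "nat \<Rightarrow> (real^'n::finite) set \<Rightarrow> real \<Rightarrow> ((real^'n) \<times> real \<Rightarrow> real) set" where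
  "H0 k \<Omega> T = {v \<in> sobolev k (QT \<Omega> T).
     (\<forall>x\<in>frontier \<Omega>. \<forall>t\<in>{0<..<T}. v (x, t) = 0) \<and> (\<forall>x\<in>\<Omega>. v (x, T) = 0)}"

definition B_open ::
  "nat \<Rightarrow> (real^'n::finite) set \<Rightarrow> real \<Rightarrow> real \<Rightarrow> ((real^'n) \<times> real \<Rightarrow> real) set" where
  "B_open k \<Omega> T R = {v \<in> H0 k \<Omega> T. sobolev_norm k (QT \<Omega> T) v < R}"

definition B_closed ::
  "nat \<Rightarrow> (real^'n::finite) set \<Rightarrow> real \<Rightarrow> real \<Rightarrow> ((real^'n) \<times> real \<Rightarrow> real) set" where
  "B_closed k \<Omega> T R = {v \<in> H0 k \<Omega> T. sobolev_norm k (QT \<Omega> T) v \<le> R}"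

definition proj_B ::
  "nat \<Rightarrow> (real^'n::finite) set \<Rightarrow> real \<Rightarrow> real \<Rightarrow> ((real^'n) \<times> real \<Rightarrow> real) \<Rightarrow> (real^'n) \<times> real \<Rightarrow> real"
  where
  "proj_B k \<Omega> T R v = (SOME w. w \<in> B_closed k \<Omega> T R \<and>
     (\<forall>y\<in>B_closed k \<Omega> T R.
        sobolev_norm k (QT \<Omega> T) (\<lambda>z. v z - w z) \<le> sobolev_norm k (QT \<Omega> T) (\<lambda>z. v z - y z)))"


section \<open>The equation and its data\<close>

text \<open>\<open>M\<close> is the maximum of the norms of the coefficients in \<open>C\<^sup>1(closure Q\<^sub>T)\<close>.\<close>

definition coefficients ::
  "(real^'n::finite) set \<Rightarrow> real \<Rightarrow> real \<Rightarrow> real \<Rightarrow> real \<Rightarrow>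
   ('n \<Rightarrow> 'n \<Rightarrow> (real^'n) \<times> real \<Rightarrow> real) \<Rightarrow> bool" where
  "coefficients \<Omega> T \<mu>1 \<mu>2 M a \<longleftrightarrow>
     (\<forall>i j. C_closed 1 (QT \<Omega> T) (a i j)) \<and>
     (\<forall>i j. \<forall>z\<in>closure (QT \<Omega> T). a i j z = a j i z) \<and>
     (\<forall>z\<in>closure (QT \<Omega> T). \<forall>\<xi> :: real^'n.
        \<mu>1 * (norm \<xi>)\<^sup>2 \<le> (\<Sum>i\<in>UNIV. \<Sum>j\<in>UNIV. a i j z * \<xi> $ i * \<xi> $ j) \<and>
        (\<Sum>i\<in>UNIV. \<Sum>j\<in>UNIV. a i j z * \<xi> $ i * \<xi> $ j) \<le> \<mu>2 * (norm \<xi>)\<^sup>2) \<and>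
     M = Max {C_norm 1 (QT \<Omega> T) (a i j) | i j. True}"

text \<open>The nested product type of the arguments \<open>(p, s, x, t)\<close> carries the Euclidean norm of
  \<open>\<real>\<^sup>2\<^sup>n\<^sup>+\<^sup>2\<close>.\<close>

definition nonlinearity ::
  "real \<Rightarrow> ((real^'n::finite) \<times> real \<times> (real^'n) \<times> real \<Rightarrow> real) \<Rightarrow> bool" where
  "nonlinearity C F \<longleftrightarrow> C_open 1 UNIV F \<and> C-lipschitz_on UNIV F"

definition terminal_data :: "(real^'n::finite) set \<Rightarrow> (real^'n \<Rightarrow> real) \<Rightarrow> bool" where
  "terminal_data \<Omega> g \<longleftrightarrow> C_closed 2 \<Omega> g \<and> (\<forall>x\<in>frontier \<Omega>. g x = 0)"

definition op_L ::
  "('n::finite \<Rightarrow> 'n \<Rightarrow> (real^'n) \<times> real \<Rightarrow> real) \<Rightarrow> ((real^'n) \<times> real \<Rightarrow> real) \<Rightarrow> (real^'n) \<times> real \<Rightarrow> real"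
  where
  "op_L a u z = (\<Sum>i\<in>UNIV. \<Sum>j\<in>UNIV. a i j z * iter_partial [dir_x j, dir_x i] u z)"

text \<open>A function \<open>g\<close> of \<open>x\<close> alone enters as the function \<open>g \<circ> fst\<close> of \<open>(x, t)\<close>.\<close>

definition op_G ::
  "('n::finite \<Rightarrow> 'n \<Rightarrow> (real^'n) \<times> real \<Rightarrow> real) \<Rightarrow>
   ((real^'n) \<times> real \<times> (real^'n) \<times> real \<Rightarrow> real) \<Rightarrow> (real^'n \<Rightarrow> real) \<Rightarrow>
   ((real^'n) \<times> real \<Rightarrow> real) \<Rightarrow> (real^'n) \<times> real \<Rightarrow> real" where
  "op_G a F g v z = op_L a (g \<circ> fst) z +
     F (grad_x v z + grad_x (g \<circ> fst) z, v z + g (fst z), fst z, snd z)"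

definition exact_solution ::
  "(real^'n::finite) set \<Rightarrow> real \<Rightarrow> ('n \<Rightarrow> 'n \<Rightarrow> (real^'n) \<times> real \<Rightarrow> real) \<Rightarrow>
   ((real^'n) \<times> real \<times> (real^'n) \<times> real \<Rightarrow> real) \<Rightarrow> (real^'n \<Rightarrow> real) \<Rightarrow>
   ((real^'n) \<times> real \<Rightarrow> real) \<Rightarrow> bool" where
  "exact_solution \<Omega> T a F g v \<longleftrightarrow>
     (\<forall>z\<in>QT \<Omega> T. partial dir_t v z = op_L a v z + op_G a F g v z) \<and>
     (\<forall>x\<in>frontier \<Omega>. \<forall>t\<in>{0<..<T}. v (x, t) = 0) \<and> (\<forall>x\<in>\<Omega>. v (x, T) = 0)"


section \<open>The Tikhonov-like functional\<close>

definition tikhonov ::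
  "nat \<Rightarrow> (real^'n::finite) set \<Rightarrow> real \<Rightarrow> real \<Rightarrow> ('n \<Rightarrow> 'n \<Rightarrow> (real^'n) \<times> real \<Rightarrow> real) \<Rightarrow>
   ((real^'n) \<times> real \<times> (real^'n) \<times> real \<Rightarrow> real) \<Rightarrow> (real^'n \<Rightarrow> real) \<Rightarrow> real \<Rightarrow> real \<Rightarrow>
   ((real^'n) \<times> real \<Rightarrow> real) \<Rightarrow> real" where
  "tikhonov k \<Omega> T \<tau> a F g \<alpha> \<nu> v =
     exp (- 2 * (\<tau> + 1) powr \<nu>) *
       (LINT z:QT \<Omega> T|lborel.
          (partial dir_t v z - op_L a v z - op_G a F g v z)\<^sup>2 * exp (2 * (snd z + 1) powr \<nu>))
     + \<alpha> * (sobolev_norm k (QT \<Omega> T) v)\<^sup>2"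

text \<open>\<open>d \<in> H\<^sub>0\<^sup>k\<close> is the Riesz representative of the Frechet derivative at \<open>v\<close> of a functional \<open>J\<close>
  on \<open>H\<^sub>0\<^sup>k\<close>.\<close>

definition is_frechet_grad ::
  "nat \<Rightarrow> (real^'n::finite) set \<Rightarrow> real \<Rightarrow> (((real^'n) \<times> real \<Rightarrow> real) \<Rightarrow> real) \<Rightarrow>
   ((real^'n) \<times> real \<Rightarrow> real) \<Rightarrow> ((real^'n) \<times> real \<Rightarrow> real) \<Rightarrow> bool" where
  "is_frechet_grad k \<Omega> T J v d \<longleftrightarrow> d \<in> H0 k \<Omega> T \<and>
     (\<forall>\<epsilon>>0. \<exists>\<eta>>0. \<forall>h\<in>H0 k \<Omega> T. sobolev_norm k (QT \<Omega> T) h < \<eta> \<longrightarrow>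
        \<bar>J (\<lambda>z. v z + h z) - J v - sobolev_inner k (QT \<Omega> T) d h\<bar> \<le> \<epsilon> * sobolev_norm k (QT \<Omega> T) h)"

definition frechet_grad ::
  "nat \<Rightarrow> (real^'n::finite) set \<Rightarrow> real \<Rightarrow> (((real^'n) \<times> real \<Rightarrow> real) \<Rightarrow> real) \<Rightarrow>
   ((real^'n) \<times> real \<Rightarrow> real) \<Rightarrow> (real^'n) \<times> real \<Rightarrow> real" where
  "frechet_grad k \<Omega> T J v = (SOME d. is_frechet_grad k \<Omega> T J v d)"

definition unique_minimizer :: "('v \<Rightarrow> real) \<Rightarrow> 'v set \<Rightarrow> 'v \<Rightarrow> bool" where
  "unique_minimizer J S v \<longleftrightarrow> v \<in> S \<and> (\<forall>w\<in>S. w \<noteq> v \<longrightarrow> J v < J w)"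

text \<open>The strict convexity property of the functional with the numbers \<open>\<nu>\<^sub>3\<close> and \<open>C\<^sub>2\<close>. It includes the
  existence of the Frechet derivative on the closed ball.\<close>

definition strict_convexity_property ::
  "nat \<Rightarrow> (real^'n::finite) set \<Rightarrow> real \<Rightarrow> real \<Rightarrow> real \<Rightarrow>
   ('n \<Rightarrow> 'n \<Rightarrow> (real^'n) \<times> real \<Rightarrow> real) \<Rightarrow>
   ((real^'n) \<times> real \<times> (real^'n) \<times> real \<Rightarrow> real) \<Rightarrow> (real^'n \<Rightarrow> real) \<Rightarrow> real \<Rightarrow> real \<Rightarrow> bool" where
  "strict_convexity_property k \<Omega> T \<tau> R a F g \<nu>3 C2 \<longleftrightarrow>
     (\<forall>\<nu>\<ge>\<nu>3. 2 * C2 * exp (- 2 * (\<tau> + 1) powr \<nu>) \<in> {0<..<1} \<and>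
       (\<forall>\<alpha>\<in>{2 * C2 * exp (- 2 * (\<tau> + 1) powr \<nu>)..<1}.
         let J = tikhonov k \<Omega> T \<tau> a F g \<alpha> \<nu> in
         \<forall>v1\<in>B_closed k \<Omega> T R. (\<exists>d. is_frechet_grad k \<Omega> T J v1 d) \<and>
           (\<forall>v2\<in>B_closed k \<Omega> T R.
              J v2 - J v1 - sobolev_inner k (QT \<Omega> T) (frechet_grad k \<Omega> T J v1) (\<lambda>z. v2 z - v1 z)
              \<ge> C2 * (H10_norm (cylinder \<Omega> \<tau> T) (\<lambda>z. v2 z - v1 z))\<^sup>2
                + \<alpha> / 2 * (sobolev_norm k (QT \<Omega> T) (\<lambda>z. v2 z - v1 z))\<^sup>2)))"

primrec gradient_projection ::
  "nat \<Rightarrow> (real^'n::finite) set \<Rightarrow> real \<Rightarrow> real \<Rightarrow> (((real^'n) \<times> real \<Rightarrow> real) \<Rightarrow> real) \<Rightarrow> real \<Rightarrow>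
   ((real^'n) \<times> real \<Rightarrow> real) \<Rightarrow> nat \<Rightarrow> (real^'n) \<times> real \<Rightarrow> real" where
  "gradient_projection k \<Omega> T R J \<gamma> v0 0 = v0"
| "gradient_projection k \<Omega> T R J \<gamma> v0 (Suc m) =
     proj_B k \<Omega> T R
       (\<lambda>z. gradient_projection k \<Omega> T R J \<gamma> v0 m z
            - \<gamma> * frechet_grad k \<Omega> T J (gradient_projection k \<Omega> T R J \<gamma> v0 m) z)"

definition converges_at_rate ::
  "nat \<Rightarrow> (real^'n::finite) set \<Rightarrow> real \<Rightarrow> real \<Rightarrow> (((real^'n) \<times> real \<Rightarrow> real) \<Rightarrow> real) \<Rightarrow>
   ((real^'n) \<times> real \<Rightarrow> real) \<Rightarrow> real \<Rightarrow> real \<Rightarrow> bool" where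
  "converges_at_rate k \<Omega> T R J vmin \<gamma> \<theta> \<longleftrightarrow>
     (\<forall>v0\<in>B_open k \<Omega> T R. \<forall>m\<ge>1.
        sobolev_norm k (QT \<Omega> T) (\<lambda>z. gradient_projection k \<Omega> T R J \<gamma> v0 m z - vmin z)
        \<le> \<theta> ^ m * sobolev_norm k (QT \<Omega> T) (\<lambda>z. vmin z - v0 z))"

definition gradient_projection_property ::
  "nat \<Rightarrow> (real^'n::finite) set \<Rightarrow> real \<Rightarrow> real \<Rightarrow> (((real^'n) \<times> real \<Rightarrow> real) \<Rightarrow> real) \<Rightarrow>
   ((real^'n) \<times> real \<Rightarrow> real) \<Rightarrow> real \<Rightarrow> bool" where
  "gradient_projection_property k \<Omega> T R J vmin \<gamma>0 \<longleftrightarrow>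
     (\<forall>\<gamma>\<in>{0<..<\<gamma>0}. \<exists>\<theta>\<in>{0<..<1}. converges_at_rate k \<Omega> T R J vmin \<gamma> \<theta>)"


section \<open>Choice of the parameters\<close>

definition nu_of :: "real \<Rightarrow> real \<Rightarrow> real" where
  "nu_of T \<delta> = ln ((ln (\<delta> powr (- 1 / 2))) powr (1 / ln (T + 1)))"

definition alpha_of :: "real \<Rightarrow> real \<Rightarrow> real \<Rightarrow> real \<Rightarrow> real" where
  "alpha_of T \<tau> C2 \<delta> = 2 * C2 * exp (- 2 * (\<tau> + 1) powr nu_of T \<delta>)"

definition rate_exponent :: "real \<Rightarrow> real \<Rightarrow> real" where
  "rate_exponent \<tau> T = ln (\<tau> + 1) / ln (T + 1)"

definition error_rate :: "real \<Rightarrow> real \<Rightarrow> real" where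
  "error_rate c \<delta> = exp (- (1 / 2 powr c) * (ln (1 / \<delta>)) powr c)"

end

theory Submission
  imports Defs
begin

text \<open>
  The exact solution nearly minimizes the functional \<open>J\<close> built from noisy data, and strict
  convexity turns this into closeness to the minimizer. Strict convexity between \<open>vmin\<close> and \<open>vs\<close> reads
  \<open>C2 * \<parallel>vs - vmin\<parallel>\<^sup>2 \<le> J vs - J vmin - J'(vmin)(vs - vmin)\<close>. The subtracted terms are nonnegative, the last one
  because \<open>vmin\<close> minimizes \<open>J\<close> on a convex set, so \<open>J vs\<close> bounds the error
  (\<open>minimizer_error_estimate\<close>). In \<open>J vs\<close> the equation is satisfied up to the effect of the data error, of
  order \<open>\<delta>\<close> (\<open>op_G_data_error\<close>). The choice of \<open>\<nu>\<close> makes the weight at most \<open>1/\<delta>\<close> and the factor in front of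
  the integral equal to the square of the rate, and \<open>\<alpha>\<close> is a constant multiple of the same square
  (\<open>exp_powr_nu_of\<close>). Hence \<open>J vs\<close> is at most a constant times the squared rate. The estimate for
  the iterates is the triangle inequality, since the \<open>H\<^sup>1\<^sup>,\<^sup>0\<close> norm on the shorter cylinder is at most the \<open>H\<^sup>k\<close>
  norm.

  Most of the work lies in the Sobolev norms. They are defined from an arbitrary choice of weak
  derivatives, so that the triangle inequality, homogeneity and the comparison of the norms rest on the
  uniqueness of weak derivatives (\<open>is_weak_deriv_unique\<close>). Uniqueness comes from the fundamental lemma of
  the calculus of variations (\<open>test_functions_separate\<close>), and this from an explicit construction of smooth
  bumps. What remains is the geometry of balls in a semi-inner product space: the
  projection onto a centred ball is explicit (\<open>ball_projection_exists\<close>), and a minimizer on the ball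
  satisfies a variational inequality (\<open>variational_inequality\<close>).
\<close>

section \<open>Smooth bumps\<close>

text \<open>The function \<open>flat 0\<close> is the classical function \<open>exp (-1/x)\<close>, extended by \<open>0\<close>, that is flat at the
  origin. The factors \<open>(1/x)\<^sup>k\<close> are what its derivatives produce: the derivative of \<open>flat k\<close> is a linear
  combination of \<open>flat (k + 1)\<close> and \<open>flat (k + 2)\<close>, so the whole family can be differentiated
  without leaving it.\<close>

definition flat :: "nat \<Rightarrow> real \<Rightarrow> real" where
  "flat k x = (if x > 0 then (1 / x) ^ k * exp (- (1 / x)) else 0)"

lemma flat_tendsto_0: "(flat k \<longlongrightarrow> 0) (at 0)"
proof -
  have "((\<lambda>y::real. y ^ k / exp y) \<longlongrightarrow> 0) at_top"
    by (rule tendsto_power_div_exp_0)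
  then have "((\<lambda>x::real. inverse x ^ k / exp (inverse x)) \<longlongrightarrow> 0) (at_right 0)"
    by (rule filterlim_compose) (rule filterlim_inverse_at_top_right)
  then have right: "(flat k \<longlongrightarrow> 0) (at_right 0)"
    by (rule Lim_transform_eventually)
       (auto simp: flat_def eventually_at_filter exp_minus divide_simps)
  have left: "(flat k \<longlongrightarrow> 0) (at_left 0)"
    by (rule Lim_transform_eventually[OF tendsto_const])
       (auto simp: flat_def eventually_at_filter)
  show ?thesis using left right by (simp add: filterlim_split_at)
qed

lemma flat_has_derivative:
  "(flat k has_field_derivative (flat (k + 2) x - real k * flat (k + 1) x)) (at x)"
proof -
  consider "x > 0" | "x < 0" | "x = 0" by linarith
  then show ?thesis
  proof cases
    case 1
    have "((\<lambda>x. (1 / x) ^ k * exp (- (1 / x))) has_field_derivative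
        (flat (k + 2) x - real k * flat (k + 1) x)) (at x)"
      using 1
      apply (auto intro!: derivative_eq_intros simp: flat_def)
      apply (cases k)
      apply (auto simp: field_simps power2_eq_square)
      done
    then show ?thesis
      by (rule has_field_derivative_transform_within_open[where S = "{0<..}"])
         (use 1 in \<open>auto simp: flat_def\<close>)
  next
    case 2
    have "((\<lambda>x. 0) has_field_derivative (flat (k + 2) x - real k * flat (k + 1) x)) (at x)"
      using 2 by (auto simp: flat_def)
    then show ?thesis
      by (rule has_field_derivative_transform_within_open[where S = "{..<0}"])
         (use 2 in \<open>auto simp: flat_def\<close>)
  next
    case 3
    \<comment> \<open>The difference quotient of \<open>flat k\<close> at the origin is \<open>flat (Suc k)\<close>.\<close>
    have "((\<lambda>h. (flat k (0 + h) - flat k 0) / h) \<longlongrightarrow> 0) (at 0)"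
      by (rule Lim_transform_eventually[OF flat_tendsto_0[of "Suc k"]])
         (auto simp: flat_def eventually_at_filter)
    then show ?thesis
      using 3 by (simp add: DERIV_def flat_def)
  qed
qed

lemma flat_continuous: "continuous_on UNIV (flat k)"
  by (meson DERIV_continuous_on flat_has_derivative has_field_derivative_at_within)

text \<open>The algebra generated by the flat functions of one linear coordinate. Since the generators have
  derivatives in the algebra, the product rule makes it closed under all directional derivatives
  (\<open>bump_algebra_derivative\<close>), and smoothness of its elements needs no estimate of
  higher derivatives.\<close>

inductive bump_algebra :: "('a::euclidean_space \<Rightarrow> real) \<Rightarrow> bool" where
  const: "bump_algebra (\<lambda>z. c)"
| flat: "bump_algebra (\<lambda>z. flat k (e \<bullet> z + d))"
| add: "bump_algebra f \<Longrightarrow> bump_algebra g \<Longrightarrow> bump_algebra (\<lambda>z. f z + g z)"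
| mult: "bump_algebra f \<Longrightarrow> bump_algebra g \<Longrightarrow> bump_algebra (\<lambda>z. f z * g z)"

lemma bump_algebra_prod:
  assumes "\<And>i. i \<in> I \<Longrightarrow> bump_algebra (f i)"
  shows "bump_algebra (\<lambda>z. \<Prod>i\<in>I. f i z)"
  using assms
  by (induction I rule: infinite_finite_induct) (auto intro: bump_algebra.intros)

lemma bump_algebra_continuous: "bump_algebra f \<Longrightarrow> continuous_on UNIV f"
  by (induction rule: bump_algebra.induct)
     (auto intro!: continuous_intros continuous_on_compose2[OF flat_continuous])

lemma bump_algebra_derivative:
  assumes "bump_algebra f"
  shows "\<exists>f'. bump_algebra f' \<and>
    (\<forall>z. ((\<lambda>s::real. f (z + s *\<^sub>R b)) has_field_derivative f' z) (at 0))"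
  using assms
proof induction
  case (const c)
  then show ?case by (auto intro: exI[of _ "\<lambda>z. 0"] bump_algebra.const)
next
  case (flat k e d)
  let ?f' = "\<lambda>z. (e \<bullet> b) * (flat (k + 2) (e \<bullet> z + d) + (- real k) * flat (k + 1) (e \<bullet> z + d))"
  have "((\<lambda>s::real. flat k (e \<bullet> (z + s *\<^sub>R b) + d)) has_field_derivative ?f' z) (at 0)" for z
    by (rule DERIV_chain'[where f = "\<lambda>s. e \<bullet> (z + s *\<^sub>R b) + d" and D = "e \<bullet> b", THEN DERIV_cong])
       (auto intro!: derivative_eq_intros flat_has_derivative simp: inner_add_right)
  moreover have "bump_algebra ?f'"
    by (intro bump_algebra.intros)
  ultimately show ?case by blast
next
  case (add f g)
  then obtain f' g' where *: "bump_algebra f'" "bump_algebra g'"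
    "\<And>z. ((\<lambda>s::real. f (z + s *\<^sub>R b)) has_field_derivative f' z) (at 0)"
    "\<And>z. ((\<lambda>s::real. g (z + s *\<^sub>R b)) has_field_derivative g' z) (at 0)"
    by blast
  then show ?case
    by (intro exI[of _ "\<lambda>z. f' z + g' z"]) (auto intro: bump_algebra.intros DERIV_add)
next
  case (mult f g)
  then obtain f' g' where *: "bump_algebra f'" "bump_algebra g'"
    "\<And>z. ((\<lambda>s::real. f (z + s *\<^sub>R b)) has_field_derivative f' z) (at 0)"
    "\<And>z. ((\<lambda>s::real. g (z + s *\<^sub>R b)) has_field_derivative g' z) (at 0)"
    by blast
  have "((\<lambda>s::real. f (z + s *\<^sub>R b) * g (z + s *\<^sub>R b)) has_field_derivative f' z * g z + g' z * f z) (at 0)" for z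
    using DERIV_mult[OF *(3)[of z] *(4)[of z]] by simp
  with mult.hyps *(1,2) show ?case
    by (intro exI[of _ "\<lambda>z. f' z * g z + g' z * f z"]) (auto intro: bump_algebra.intros)
qed

lemma bump_algebra_iter_partial:
  assumes "bump_algebra f"
  shows "bump_algebra (iter_partial bs f)"
proof (induction bs)
  case Nil
  then show ?case using assms by simp
next
  case (Cons b bs)
  obtain f' where "bump_algebra f'"
    "\<And>z. ((\<lambda>s::real. iter_partial bs f (z + s *\<^sub>R b)) has_field_derivative f' z) (at 0)"
    using bump_algebra_derivative[OF Cons] by blast
  then have "iter_partial (b # bs) f = f'"
    by (auto simp: partial_def fun_eq_iff intro!: DERIV_imp_deriv)
  then show ?case using \<open>bump_algebra f'\<close> by simp
qed

lemma bump_algebra_smooth: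
  assumes "bump_algebra f"
  shows "C_open m UNIV f"
proof -
  have "(\<lambda>s::real. iter_partial bs f (z + s *\<^sub>R b)) differentiable (at 0)" for bs b z
    using bump_algebra_derivative[OF bump_algebra_iter_partial[OF assms], of bs b]
    unfolding real_differentiable_def by blast
  then show ?thesis
    unfolding C_open_def
    using bump_algebra_continuous[OF bump_algebra_iter_partial[OF assms]] by blast
qed

definition box_bump :: "'a::euclidean_space \<Rightarrow> 'a \<Rightarrow> nat \<Rightarrow> 'a \<Rightarrow> real" where
  "box_bump a b m z = (\<Prod>e\<in>Basis. flat 0 (real m * (z \<bullet> e - a \<bullet> e)) * flat 0 (real m * (b \<bullet> e - z \<bullet> e)))"

lemma flat_0_range: "0 \<le> flat 0 x" "flat 0 x \<le> 1"
  by (auto simp: flat_def)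

lemma box_bump_range: "0 \<le> box_bump a b m z" "box_bump a b m z \<le> 1"
  unfolding box_bump_def
  by (auto intro!: prod_nonneg prod_le_1 mult_le_one flat_0_range mult_nonneg_nonneg)

lemma box_bump_outside:
  assumes "z \<notin> box a b"
  shows "box_bump a b m z = 0"
proof -
  obtain e where e: "e \<in> Basis" "z \<bullet> e \<le> a \<bullet> e \<or> b \<bullet> e \<le> z \<bullet> e"
    using assms by (auto simp: mem_box not_less)
  then have "flat 0 (real m * (z \<bullet> e - a \<bullet> e)) * flat 0 (real m * (b \<bullet> e - z \<bullet> e)) = 0"
    by (auto simp: flat_def zero_less_mult_iff)
  then show ?thesis
    unfolding box_bump_def using e(1) by (meson finite_Basis prod_zero)
qed

text \<open>Scaling by \<open>m\<close> steepens the flanks: \<open>flat 0 (m x)\<close> tends to \<open>1\<close> for every \<open>x > 0\<close> and stays \<open>0\<close> for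
  \<open>x \<le> 0\<close>. So the bumps are bounded test functions converging pointwise to the indicator of the box.\<close>

lemma box_bump_tendsto: "(\<lambda>m. box_bump a b m z) \<longlonglongrightarrow> indicat_real (box a b) z"
proof (cases "z \<in> box a b")
  case True
  have one: "(\<lambda>m. flat 0 (real m * x)) \<longlonglongrightarrow> 1" if "x > 0" for x
  proof -
    have "(\<lambda>m. exp (- (1 / x) * inverse (real m))) \<longlonglongrightarrow> exp (- (1 / x) * 0)"
      by (intro tendsto_intros LIMSEQ_inverse_real_of_nat lim_inverse_n)
    then have "(\<lambda>m. exp (- (1 / x) * inverse (real m))) \<longlonglongrightarrow> 1" by simp
    then show ?thesis
      by (rule Lim_transform_eventually)
         (use that in \<open>auto simp: flat_def field_simps intro!: eventually_sequentiallyI[of 1]\<close>)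
  qed
  have "(\<lambda>m. box_bump a b m z) \<longlonglongrightarrow> (\<Prod>e\<in>(Basis::'a set). 1 * 1)"
    unfolding box_bump_def
    by (intro tendsto_prod tendsto_mult one) (use True in \<open>auto simp: mem_box\<close>)
  then show ?thesis using True by simp
qed (auto simp: box_bump_outside)

lemma box_bump_test_function:
  assumes "cbox a b \<subseteq> Q"
  shows "test_function Q (box_bump a b m)"
proof -
  have "{z. box_bump a b m z \<noteq> 0} \<subseteq> cbox a b"
    using box_bump_outside box_subset_cbox by blast
  then have sub: "closure {z. box_bump a b m z \<noteq> 0} \<subseteq> cbox a b"
    by (rule closure_minimal) (rule closed_cbox)
  then have "compact (closure {z. box_bump a b m z \<noteq> 0})"
    by (meson bounded_cbox bounded_subset closed_closure compact_eq_bounded_closed)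
  moreover have "bump_algebra (box_bump a b m)"
  proof -
    have "bump_algebra (\<lambda>z. \<Prod>e\<in>Basis. flat 0 ((real m *\<^sub>R e) \<bullet> z + (- real m * (a \<bullet> e))) *
            flat 0 ((- real m *\<^sub>R e) \<bullet> z + real m * (b \<bullet> e)))"
      by (intro bump_algebra_prod bump_algebra.intros)
    then show ?thesis
      by (rule back_subst[of bump_algebra]) 
        (auto simp: box_bump_def fun_eq_iff algebra_simps inner_commute intro!: prod.cong)
  qed
  ultimately show ?thesis
    using sub assms bump_algebra_smooth unfolding test_function_def by blast
qed

section \<open>Weak derivatives\<close>

text \<open>The fundamental lemma of the calculus of variations. By dominated convergence along the bumps, \<open>f\<close>
  has integral \<open>0\<close> over every closed box inside \<open>Q\<close>; by Lebesgue differentiation, \<open>f x\<close> is for almost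
  every \<open>x\<close> the limit of its averages over small boxes at \<open>x\<close>, hence \<open>0\<close>.\<close>

lemma test_functions_separate:
  fixes f :: "'a::euclidean_space \<Rightarrow> real"
  assumes "open Q" and f: "integrable lborel f"
    and zero: "\<And>\<phi>. test_function Q \<phi> \<Longrightarrow> (\<integral>z. f z * \<phi> z \<partial>lborel) = 0"
  shows "AE z in lborel. z \<in> Q \<longrightarrow> f z = 0"
proof -
  have [measurable]: "f \<in> borel_measurable borel"
    using f by simp
  have box: "integral (cbox a b) f = 0" if sub: "cbox a b \<subseteq> Q" for a b
  proof -
    have cont: "continuous_on UNIV (box_bump a b m)" for m
      using box_bump_test_function[OF sub, of m] unfolding test_function_def C_open_def
      by (metis empty_iff empty_set iter_partial.simps(1) le0 list.size(3) subsetI)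
    have [measurable]: "box_bump a b m \<in> borel_measurable borel" for m
      by (rule borel_measurable_continuous_onI) (rule cont)
    have "(\<lambda>m. \<integral>z. f z * box_bump a b m z \<partial>lborel) \<longlonglongrightarrow> (\<integral>z. f z * indicator (box a b) z \<partial>lborel)"
    proof (rule integral_dominated_convergence[where w = "\<lambda>z. \<bar>f z\<bar>"])
      show "AE z in lborel. (\<lambda>m. f z * box_bump a b m z) \<longlonglongrightarrow> f z * indicator (box a b) z"
        by (intro AE_I2 tendsto_mult tendsto_const box_bump_tendsto)
      show "AE z in lborel. norm (f z * box_bump a b m z) \<le> \<bar>f z\<bar>" for m
        using box_bump_range[of a b m] by (auto simp: abs_mult mult_left_le)
    qed (use f in auto)
    then have 0: "(\<integral>z. f z * indicator (box a b) z \<partial>lborel) = 0"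
      using zero[OF box_bump_test_function[OF sub]] by (simp add: LIMSEQ_const_iff)
    have "integrable lborel (\<lambda>z. f z * indicator (box a b) z)"
      using f by (simp add: integrable_real_mult_indicator)
    from has_integral_integral_lborel[OF this] 0
    have "((\<lambda>z. f z * indicator (box a b) z) has_integral 0) UNIV" by simp
    then have "((\<lambda>z. if z \<in> box a b then f z else 0) has_integral 0) UNIV"
      by (rule has_integral_eq[rotated]) auto
    then have "(f has_integral 0) (box a b)"
      by (simp only: has_integral_restrict_UNIV)
    then show ?thesis
      by (metis integral_open_interval integral_unique)
  qed
  have "f integrable_on cbox a b" for a b
    using integrable_on_lborel[OF f] by (rule integrable_on_subcbox) simp
  then obtain N where N: "negligible N"
    "\<And>x e. x \<notin> N \<Longrightarrow> 0 < e \<Longrightarrow> \<exists>d>0. \<forall>h. 0 < h \<and> h < d \<longrightarrow>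
        norm (integral (cbox x (x + h *\<^sub>R One)) f /\<^sub>R h ^ DIM('a) - f x) < e"
    using integrable_ccontinuous_explicit by blast
  have f0: "f x = 0" if "x \<notin> N" "x \<in> Q" for x
  proof (rule ccontr)
    assume "f x \<noteq> 0"
    then obtain d where d: "d > 0" "\<And>h. 0 < h \<Longrightarrow> h < d \<Longrightarrow>
        norm (integral (cbox x (x + h *\<^sub>R One)) f /\<^sub>R h ^ DIM('a) - f x) < \<bar>f x\<bar>"
      using N(2)[OF \<open>x \<notin> N\<close>, of "\<bar>f x\<bar>"] by auto
    obtain r where r: "r > 0" "cball x r \<subseteq> Q"
      using \<open>open Q\<close> \<open>x \<in> Q\<close> open_contains_cball by blast
    \<comment> \<open>The box of side \<open>h\<close> has diameter at most \<open>h * DIM('a)\<close>, measured in the sum norm.\<close>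
    define h where "h = min (d / 2) (r / DIM('a))"
    have h: "0 < h" "h < d" "h * DIM('a) \<le> r"
      using d(1) r(1) by (auto simp: h_def min_def field_simps)
    have "cbox x (x + h *\<^sub>R One) \<subseteq> cball x r"
    proof
      fix y assume y: "y \<in> cbox x (x + h *\<^sub>R One)"
      have "norm (y - x) \<le> (\<Sum>b\<in>Basis. \<bar>(y - x) \<bullet> b\<bar>)" by (rule norm_le_l1)
      also have "\<dots> \<le> (\<Sum>b\<in>(Basis::'a set). h)"
        using y by (intro sum_mono) (auto simp: mem_box algebra_simps abs_le_iff)
      also have "\<dots> \<le> r" using h(3) by (simp add: mult.commute)
      finally show "y \<in> cball x r" by (simp add: dist_norm norm_minus_commute)
    qed
    then have "integral (cbox x (x + h *\<^sub>R One)) f = 0"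
      using r(2) by (intro box) auto
    with d(2)[OF h(1,2)] show False by simp
  qed
  have "AE x in lebesgue. x \<notin> N"
    using N(1) negligible_iff_null_sets AE_not_in by blast
  then have "AE x in lborel. x \<notin> N"
    by (simp only: AE_completion_iff)
  then show ?thesis
    by eventually_elim (use f0 in blast)
qed

lemma set_integrable_square_mult:
  assumes f: "square_integrable Q f" and g: "square_integrable Q g"
  shows "set_integrable lborel Q (\<lambda>z. f z * g z)"
proof (rule set_integrable_bound)
  show "set_integrable lborel Q (\<lambda>z. (f z)\<^sup>2 + (g z)\<^sup>2)"
    using f g unfolding square_integrable_def by (intro set_integral_add) auto
  have "(\<lambda>z. (indicator Q z *\<^sub>R f z) * (indicator Q z *\<^sub>R g z)) \<in> borel_measurable lborel"
    using f g unfolding square_integrable_def set_borel_measurable_def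
    by (intro borel_measurable_times) auto
  then show "set_borel_measurable lborel Q (\<lambda>z. f z * g z)"
    unfolding set_borel_measurable_def
    by (rule measurable_cong[THEN iffD1, rotated]) (auto split: split_indicator)
  have "\<bar>f z * g z\<bar> \<le> (f z)\<^sup>2 + (g z)\<^sup>2" for z
  proof -
    have "2 * (\<bar>f z\<bar> * \<bar>g z\<bar>) \<le> (f z)\<^sup>2 + (g z)\<^sup>2"
      using zero_le_power2[of "\<bar>f z\<bar> - \<bar>g z\<bar>"] by (simp add: power2_diff)
    moreover have "0 \<le> \<bar>f z\<bar> * \<bar>g z\<bar>" by simp
    ultimately show ?thesis unfolding abs_mult by linarith
  qed
  then show "AE z in lborel. z \<in> Q \<longrightarrow> norm (f z * g z) \<le> norm ((f z)\<^sup>2 + (g z)\<^sup>2)"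
    by (intro AE_I2) (simp add: abs_of_nonneg add_nonneg_nonneg)
qed

lemma square_integrable_lincomb:
  assumes f: "square_integrable Q f" and g: "square_integrable Q g"
  shows "square_integrable Q (\<lambda>z. p * f z + q * g z)"
proof -
  have "(\<lambda>z. p * (indicator Q z *\<^sub>R f z) + q * (indicator Q z *\<^sub>R g z)) \<in> borel_measurable lborel"
    using f g unfolding square_integrable_def set_borel_measurable_def
    by (intro borel_measurable_add borel_measurable_times) auto
  then have "set_borel_measurable lborel Q (\<lambda>z. p * f z + q * g z)"
    unfolding set_borel_measurable_def
    by (rule measurable_cong[THEN iffD1, rotated]) (auto split: split_indicator)
  moreover have "set_integrable lborel Q
      (\<lambda>z. p\<^sup>2 * (f z)\<^sup>2 + ((2 * p * q) * (f z * g z) + q\<^sup>2 * (g z)\<^sup>2))"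
    using f g set_integrable_square_mult[OF f g] unfolding square_integrable_def
    by (intro set_integral_add set_integrable_mult_right) auto
  then have "set_integrable lborel Q (\<lambda>z. (p * f z + q * g z)\<^sup>2)"
    by (rule back_subst[of "set_integrable lborel Q"])
      (auto simp: fun_eq_iff power2_eq_square algebra_simps)
  ultimately show ?thesis unfolding square_integrable_def by blast
qed

lemma square_integrable_continuous:
  fixes Q :: "'a::euclidean_space set"
  assumes Q: "open Q" "bounded Q" and u: "continuous_on (closure Q) u"
  shows "square_integrable Q u"
proof -
  have c: "compact (closure Q)" using Q(2) by simp
  have "set_integrable lborel (closure Q) (\<lambda>z. (u z)\<^sup>2)"
    unfolding set_integrable_def
    by (intro borel_integrable_compact c continuous_intros u)
  then have "set_integrable lborel Q (\<lambda>z. (u z)\<^sup>2)"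
    by (rule set_integrable_subset) (use Q closure_subset in auto)
  moreover have "set_borel_measurable lborel Q u"
    unfolding set_borel_measurable_def using Q(1) u
    by (simp add: borel_measurable_continuous_on_indicator continuous_on_subset[OF _ closure_subset] del: real_scaleR_def)
  ultimately show ?thesis unfolding square_integrable_def by blast
qed

lemma square_integrable_test_function:
  assumes "open Q" "bounded Q" "test_function Q' \<phi>" "set bs \<subseteq> Basis"
  shows "square_integrable Q (iter_partial bs \<phi>)"
proof -
  have "continuous_on UNIV (iter_partial bs \<phi>)"
    using assms(3,4) unfolding test_function_def C_open_def by blast
  then show ?thesis
    by (intro square_integrable_continuous assms) (rule continuous_on_subset, auto)
qed

lemma set_lebesgue_integral_eq_AE:
  assumes "set_borel_measurable M A f" "set_borel_measurable M A g"
    and "AE x in M. x \<in> A \<longrightarrow> f x = g x"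
  shows "(LINT x:A|M. f x) = (LINT x:A|M. g x)"
  unfolding set_lebesgue_integral_def
proof (rule integral_cong_AE)
  show "AE x in M. indicator A x *\<^sub>R f x = indicator A x *\<^sub>R g x"
    using assms(3) by eventually_elim (auto split: split_indicator)
qed (use assms in \<open>auto simp: set_borel_measurable_def\<close>)

lemma is_weak_deriv_weak_deriv:
  "\<exists>f. is_weak_deriv Q \<beta> u f \<Longrightarrow> is_weak_deriv Q \<beta> u (weak_deriv Q \<beta> u)"
  unfolding weak_deriv_def by (rule someI_ex[where P = "is_weak_deriv Q \<beta> u"])

lemma weak_deriv_square_integrable:
  "\<exists>f. is_weak_deriv Q \<beta> u f \<Longrightarrow> square_integrable Q (weak_deriv Q \<beta> u)"
  by (drule is_weak_deriv_weak_deriv) (simp add: is_weak_deriv_def)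

text \<open>This is what makes \<open>weak_deriv\<close>, an arbitrary choice, usable: it agrees almost everywhere with any
  weak derivative that is computed by other means, so that linearity and restriction to subdomains
  hold for the chosen derivatives almost everywhere.\<close>

lemma is_weak_deriv_unique:
  assumes Q: "open Q" "bounded Q"
    and f: "is_weak_deriv Q \<beta> u f" and g: "is_weak_deriv Q \<beta> u g"
  shows "AE z in lborel. z \<in> Q \<longrightarrow> f z = g z"
proof -
  have sq: "square_integrable Q f" "square_integrable Q g"
    using f g by (auto simp: is_weak_deriv_def)
  have "square_integrable Q (\<lambda>z. 1)"
    using Q by (intro square_integrable_continuous) auto
  from set_integrable_square_mult[OF _ this]
  have int: "set_integrable lborel Q f" "set_integrable lborel Q g"
    using sq by force+
  have "AE z in lborel. z \<in> Q \<longrightarrow> indicator Q z *\<^sub>R (f z - g z) = 0"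
  proof (rule test_functions_separate[OF Q(1)])
    show "integrable lborel (\<lambda>z. indicator Q z *\<^sub>R (f z - g z))"
      using set_integral_diff(1)[OF int] unfolding set_integrable_def .
    fix \<phi> assume \<phi>: "test_function Q \<phi>"
    obtain bs where bs: "mset bs = \<beta>" using ex_mset by blast
    have \<phi>2: "square_integrable Q \<phi>"
      using square_integrable_test_function[OF Q \<phi>, of "[]"] by simp
    have "(- 1) ^ size \<beta> * (LINT z:Q|lborel. f z * \<phi> z) = (- 1) ^ size \<beta> * (LINT z:Q|lborel. g z * \<phi> z)"
      using f[unfolded is_weak_deriv_def, THEN conjunct2, rule_format, of \<phi> bs]
        g[unfolded is_weak_deriv_def, THEN conjunct2, rule_format, of \<phi> bs] \<phi> bs by simp
    then have "(LINT z:Q|lborel. f z * \<phi> z) = (LINT z:Q|lborel. g z * \<phi> z)"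
      by simp
    then have "(LINT z:Q|lborel. f z * \<phi> z - g z * \<phi> z) = 0"
      by (subst set_integral_diff) (auto intro: set_integrable_square_mult sq \<phi>2)
    then show "(\<integral>z. indicator Q z *\<^sub>R (f z - g z) * \<phi> z \<partial>lborel) = 0"
      by (simp add: set_lebesgue_integral_def algebra_simps)
  qed
  then show ?thesis
    by eventually_elim auto
qed

lemma is_weak_deriv_lincomb:
  assumes Q: "open Q" "bounded Q" and \<beta>: "set_mset \<beta> \<subseteq> Basis"
    and sq: "square_integrable Q u" "square_integrable Q w"
    and f: "is_weak_deriv Q \<beta> u f" and g: "is_weak_deriv Q \<beta> w g"
  shows "is_weak_deriv Q \<beta> (\<lambda>z. p * u z + q * w z) (\<lambda>z. p * f z + q * g z)"
  unfolding is_weak_deriv_def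
proof (intro conjI allI impI)
  have sq': "square_integrable Q f" "square_integrable Q g"
    using f g by (auto simp: is_weak_deriv_def)
  then show "square_integrable Q (\<lambda>z. p * f z + q * g z)"
    by (rule square_integrable_lincomb)
  fix \<phi> bs assume *: "test_function Q \<phi> \<and> mset bs = \<beta>"
  have \<phi>: "square_integrable Q (iter_partial bs \<phi>)" "square_integrable Q \<phi>"
    using square_integrable_test_function[OF Q, of Q \<phi> bs]
      square_integrable_test_function[OF Q, of Q \<phi> "[]"] * \<beta> by auto
  have lin: "(LINT z:Q|lborel. (p * h1 z + q * h2 z) * \<psi> z)
      = p * (LINT z:Q|lborel. h1 z * \<psi> z) + q * (LINT z:Q|lborel. h2 z * \<psi> z)"
    if "square_integrable Q h1" "square_integrable Q h2" "square_integrable Q \<psi>" for h1 h2 \<psi>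
  proof -
    have "(LINT z:Q|lborel. (p * h1 z + q * h2 z) * \<psi> z)
        = (LINT z:Q|lborel. p * (h1 z * \<psi> z) + q * (h2 z * \<psi> z))"
      by (simp add: algebra_simps)
    also have "\<dots> = (LINT z:Q|lborel. p * (h1 z * \<psi> z)) + (LINT z:Q|lborel. q * (h2 z * \<psi> z))"
      using that by (intro set_integral_add set_integrable_mult_right set_integrable_square_mult)
    finally show ?thesis by simp
  qed
  have "(LINT z:Q|lborel. u z * iter_partial bs \<phi> z) = (- 1) ^ size \<beta> * (LINT z:Q|lborel. f z * \<phi> z)"
    "(LINT z:Q|lborel. w z * iter_partial bs \<phi> z) = (- 1) ^ size \<beta> * (LINT z:Q|lborel. g z * \<phi> z)"
    using f g * unfolding is_weak_deriv_def by blast+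
  then show "(LINT z:Q|lborel. (p * u z + q * w z) * iter_partial bs \<phi> z)
      = (- 1) ^ size \<beta> * (LINT z:Q|lborel. (p * f z + q * g z) * \<phi> z)"
    unfolding lin[OF sq \<phi>(1)] lin[OF sq' \<phi>(2)] by (simp add: algebra_simps)
qed

lemma iter_partial_outside_support:
  assumes "z \<notin> closure {z. \<phi> z \<noteq> 0}"
  shows "iter_partial bs \<phi> z = 0"
  using assms
proof (induction bs arbitrary: z)
  case Nil
  then show ?case using closure_subset[of "{z. \<phi> z \<noteq> 0}"] by auto
next
  case (Cons b bs)
  let ?U = "- closure {z. \<phi> z \<noteq> 0}"
  have "((\<lambda>s::real. iter_partial bs \<phi> (z + s *\<^sub>R b)) has_field_derivative 0) (at 0)"
  proof (rule has_field_derivative_transform_within_open)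
    show "open ((\<lambda>s::real. z + s *\<^sub>R b) -` ?U)"
      by (intro open_vimage continuous_intros) simp
    show "((\<lambda>s. 0) has_field_derivative 0) (at (0::real))" by simp
  qed (use Cons in auto)
  then show ?case by (auto simp: partial_def intro: DERIV_imp_deriv)
qed

text \<open>A test function on the smaller set is one on the larger set, and its derivatives vanish outside its
  support, so the defining integrals over both sets coincide.\<close>

lemma is_weak_deriv_subset:
  assumes Q: "open Q'" "Q' \<subseteq> Q" and f: "is_weak_deriv Q \<beta> u f"
  shows "is_weak_deriv Q' \<beta> u f"
proof -
  have "(LINT z:Q'|lborel. h z * iter_partial bs \<phi> z) = (LINT z:Q|lborel. h z * iter_partial bs \<phi> z)"
    if "test_function Q' \<phi>" for h \<phi> bs
    unfolding set_lebesgue_integral_def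
  proof (rule Bochner_Integration.integral_cong[OF refl])
    fix z
    have "iter_partial bs \<phi> z = 0" if "z \<notin> Q'"
      using iter_partial_outside_support \<open>test_function Q' \<phi>\<close> that
      unfolding test_function_def by blast
    then show "indicator Q' z *\<^sub>R (h z * iter_partial bs \<phi> z) = indicator Q z *\<^sub>R (h z * iter_partial bs \<phi> z)"
      using Q(2) by (auto split: split_indicator)
  qed
  note eq = this
  have "test_function Q \<phi>" if "test_function Q' \<phi>" for \<phi>
    using that Q(2) unfolding test_function_def by blast
  moreover have "square_integrable Q' f"
  proof -
    have "square_integrable Q f" using f by (simp add: is_weak_deriv_def)
    then have m: "(\<lambda>z. indicator Q z *\<^sub>R f z) \<in> borel_measurable lborel"
      and i: "set_integrable lborel Q (\<lambda>z. (f z)\<^sup>2)"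
      by (auto simp: square_integrable_def set_borel_measurable_def)
    have "(\<lambda>z. indicator Q' z *\<^sub>R (indicator Q z *\<^sub>R f z)) \<in> borel_measurable lborel"
      by (rule borel_measurable_scaleR[OF borel_measurable_indicator m]) (use Q(1) in auto)
    then have "set_borel_measurable lborel Q' f"
      unfolding set_borel_measurable_def
      by (rule measurable_cong[THEN iffD1, rotated]) (use Q(2) in \<open>auto split: split_indicator\<close>)
    moreover have "set_integrable lborel Q' (\<lambda>z. (f z)\<^sup>2)"
      using i by (rule set_integrable_subset) (use Q in auto)
    ultimately show ?thesis by (simp add: square_integrable_def)
  qed
  ultimately show ?thesis
    using f eq[of _ u] eq[of _ f "[]"] unfolding is_weak_deriv_def iter_partial.simps
    by presburger
qed

lemma is_weak_deriv_empty:
  "square_integrable Q u \<Longrightarrow> is_weak_deriv Q {#} u u"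
  by (simp add: is_weak_deriv_def)

section \<open>Semi-inner products of functions\<close>

text \<open>The geometry shared by the norms of \<open>H\<^sup>k\<close> and \<open>H\<^sup>1\<^sup>,\<^sup>0\<close>. The space is a set of functions with pointwise
  operations, closed under linear combinations. Linearity is confined to the space, because weak
  derivatives need not exist elsewhere, whereas symmetry and positivity hold for the integrals in any case.\<close>

locale semi_inner_product =
  fixes V :: "('a \<Rightarrow> real) set" and ip :: "('a \<Rightarrow> real) \<Rightarrow> ('a \<Rightarrow> real) \<Rightarrow> real"
  assumes lincomb_mem: "u \<in> V \<Longrightarrow> w \<in> V \<Longrightarrow> (\<lambda>z. p * u z + q * w z) \<in> V"
    and lincomb_left: "u \<in> V \<Longrightarrow> w \<in> V \<Longrightarrow> x \<in> V \<Longrightarrow>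
      ip (\<lambda>z. p * u z + q * w z) x = p * ip u x + q * ip w x"
    and commute: "ip u w = ip w u"
    and nonneg: "0 \<le> ip u u"
begin

definition nrm :: "('a \<Rightarrow> real) \<Rightarrow> real" where
  "nrm u = sqrt (ip u u)"

lemma nrm_nonneg: "0 \<le> nrm u"
  by (simp add: nrm_def nonneg)

lemma nrm_square: "(nrm u)\<^sup>2 = ip u u"
  by (simp add: nrm_def nonneg)

lemma lincomb_square:
  assumes "u \<in> V" "w \<in> V"
  shows "ip (\<lambda>z. p * u z + q * w z) (\<lambda>z. p * u z + q * w z)
    = p\<^sup>2 * ip u u + 2 * p * q * ip u w + q\<^sup>2 * ip w w"
proof -
  let ?x = "\<lambda>z. p * u z + q * w z"
  have "ip ?x ?x = p * ip u ?x + q * ip w ?x"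
    by (rule lincomb_left[OF assms lincomb_mem[OF assms]])
  also have "\<dots> = p * ip ?x u + q * ip ?x w"
    by (simp only: commute[of _ ?x])
  also have "\<dots> = p * (p * ip u u + q * ip w u) + q * (p * ip u w + q * ip w w)"
    by (simp only: lincomb_left[OF assms assms(1)] lincomb_left[OF assms assms(2)])
  finally show ?thesis
    by (simp add: commute[of w u] power2_eq_square algebra_simps)
qed

lemma cauchy_schwarz:
  assumes "u \<in> V" "w \<in> V"
  shows "\<bar>ip u w\<bar> \<le> nrm u * nrm w"
proof -
  have pos: "0 \<le> p\<^sup>2 * ip u u + 2 * p * q * ip u w + q\<^sup>2 * ip w w" for p q
    using nonneg lincomb_square[OF assms, of p q] by metis
  have "(ip u w)\<^sup>2 \<le> ip u u * ip w w"
  proof (cases "ip w w = 0")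
    case True
    \<comment> \<open>Now the quadratic form is affine in the second coefficient, so a nonzero slope would make it negative somewhere.\<close>
    have "ip u w = 0"
    proof (rule ccontr)
      assume "ip u w \<noteq> 0"
      then show False
        using pos[of 1 "- (ip u u + 1) / (2 * ip u w)"] True by (simp add: field_simps)
    qed
    then show ?thesis using True by simp
  next
    case False
    then have w: "ip w w > 0" using nonneg[of w] by simp
    have "0 \<le> ip w w * (ip u u * ip w w - (ip u w)\<^sup>2)"
      \<comment> \<open>These coefficients minimize the quadratic form, up to a common factor.\<close>
      using pos[of "ip w w" "- ip u w"] by (simp add: power2_eq_square algebra_simps)
    then show ?thesis using w by (simp add: zero_le_mult_iff)
  qed
  then have "\<bar>ip u w\<bar> \<le> sqrt (ip u u * ip w w)"
    using real_le_rsqrt by (metis real_sqrt_abs real_sqrt_le_mono)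
  then show ?thesis by (simp add: nrm_def real_sqrt_mult)
qed

lemma scale_mem: "u \<in> V \<Longrightarrow> (\<lambda>z. p * u z) \<in> V"
  using lincomb_mem[of u u p 0] by simp

lemma add_mem: "u \<in> V \<Longrightarrow> w \<in> V \<Longrightarrow> (\<lambda>z. u z + w z) \<in> V"
  using lincomb_mem[of u w 1 1] by simp

lemma diff_mem: "u \<in> V \<Longrightarrow> w \<in> V \<Longrightarrow> (\<lambda>z. u z - w z) \<in> V"
  using lincomb_mem[of u w 1 "- 1"] by simp

lemma ip_scale_right: "u \<in> V \<Longrightarrow> x \<in> V \<Longrightarrow> ip x (\<lambda>z. p * u z) = p * ip x u"
  using lincomb_left[of u u x p 0] by (simp add: commute[of x])

lemma nrm_scale: "u \<in> V \<Longrightarrow> nrm (\<lambda>z. p * u z) = \<bar>p\<bar> * nrm u"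
  using lincomb_square[of u u p 0] by (simp add: nrm_def real_sqrt_mult)

lemma nrm_triangle:
  assumes "u \<in> V" "w \<in> V"
  shows "nrm (\<lambda>z. u z + w z) \<le> nrm u + nrm w"
proof (rule power2_le_imp_le)
  have "(nrm (\<lambda>z. u z + w z))\<^sup>2 = (nrm u)\<^sup>2 + 2 * ip u w + (nrm w)\<^sup>2"
    using lincomb_square[OF assms, of 1 1] by (simp add: nrm_square)
  also have "\<dots> \<le> (nrm u + nrm w)\<^sup>2"
    using cauchy_schwarz[OF assms] by (simp add: power2_sum)
  finally show "(nrm (\<lambda>z. u z + w z))\<^sup>2 \<le> (nrm u + nrm w)\<^sup>2" .
qed (simp add: nrm_nonneg)

lemma nrm_diff_commute:
  assumes "u \<in> V" "w \<in> V"
  shows "nrm (\<lambda>z. u z - w z) = nrm (\<lambda>z. w z - u z)"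
  using nrm_scale[OF diff_mem[OF assms(2,1)], of "- 1"] by simp

lemma nrm_diff_triangle:
  assumes "u \<in> V" "w \<in> V" "x \<in> V"
  shows "nrm (\<lambda>z. u z - x z) \<le> nrm (\<lambda>z. u z - w z) + nrm (\<lambda>z. w z - x z)"
  using nrm_triangle[OF diff_mem[OF assms(1,2)] diff_mem[OF assms(2,3)]] by simp

lemma subspace:
  assumes "V' \<subseteq> V" "\<And>u w p q. u \<in> V' \<Longrightarrow> w \<in> V' \<Longrightarrow> (\<lambda>z. p * u z + q * w z) \<in> V'"
  shows "semi_inner_product V' ip"
proof
  fix u w x p q assume "u \<in> V'" "w \<in> V'" "x \<in> V'"
  then show "ip (\<lambda>z. p * u z + q * w z) x = p * ip u x + q * ip w x"
    using assms(1) by (intro lincomb_left) auto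
qed (fact assms(2) commute nonneg)+

lemma ball_convex:
  assumes u: "u \<in> V" "nrm u \<le> R" and w: "w \<in> V" "nrm w \<le> R" and s: "0 \<le> s" "s \<le> 1"
  shows "nrm (\<lambda>z. u z + s * (w z - u z)) \<le> R"
proof -
  have "nrm (\<lambda>z. (1 - s) * u z + s * w z) \<le> nrm (\<lambda>z. (1 - s) * u z) + nrm (\<lambda>z. s * w z)"
    by (intro nrm_triangle scale_mem u w)
  also have "\<dots> = (1 - s) * nrm u + s * nrm w"
    using u w s by (simp add: nrm_scale)
  also have "\<dots> \<le> (1 - s) * R + s * R"
    using u w s by (intro add_mono mult_left_mono) auto
  finally show ?thesis by (simp add: algebra_simps)
qed

text \<open>The ball is centred at the origin, so the nearest point to \<open>v\<close> is found by scaling \<open>v\<close> back to the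
  sphere; the reverse triangle inequality shows that nothing in the ball is nearer.\<close>

lemma ball_projection_exists:
  assumes v: "v \<in> V" and R: "0 \<le> R"
  shows "\<exists>w\<in>V. nrm w \<le> R \<and>
    (\<forall>y\<in>V. nrm y \<le> R \<longrightarrow> nrm (\<lambda>z. v z - w z) \<le> nrm (\<lambda>z. v z - y z))"
proof (cases "nrm v \<le> R")
  case True
  have "nrm (\<lambda>z. v z - v z) = 0"
    using nrm_scale[OF v, of 0] by simp
  then show ?thesis using v True nrm_nonneg by (intro bexI[of _ v]) auto
next
  case False
  then have pos: "nrm v > 0" "R < nrm v" using R by auto
  define r where "r = R / nrm v"
  have r: "0 \<le> r" "r \<le> 1" "r * nrm v = R" using pos R by (auto simp: r_def)
  have "nrm (\<lambda>z. v z - r * v z) \<le> nrm (\<lambda>z. v z - y z)" if y: "y \<in> V" "nrm y \<le> R" for y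
  proof -
    have "nrm (\<lambda>z. v z - r * v z) = nrm (\<lambda>z. (1 - r) * v z)"
      by (simp add: algebra_simps)
    also have "\<dots> = nrm v - R"
      using r by (simp add: nrm_scale[OF v]) (simp add: algebra_simps)
    also have "\<dots> \<le> nrm v - nrm y" using y by simp
    also have "\<dots> \<le> nrm (\<lambda>z. v z - y z)"
      using nrm_triangle[OF diff_mem[OF v y(1)] y(1)] by simp
    finally show ?thesis .
  qed
  then show ?thesis
    using r v by (intro bexI[of _ "\<lambda>z. r * v z"]) (auto simp: nrm_scale scale_mem)
qed

text \<open>The first order condition at a minimizer of \<open>J\<close> on the ball. The segment from \<open>u\<close> to \<open>w\<close> lies in the
  ball, so \<open>J\<close> does not decrease along it; a step by a small fraction \<open>s\<close> of it and the definition of the Frechet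
  derivative give that \<open>ip d (w - u)\<close> is at least \<open>- \<epsilon>\<close> times the length of the segment, for every \<open>\<epsilon>\<close>.\<close>

lemma variational_inequality:
  assumes u: "u \<in> V" "nrm u \<le> R" and w: "w \<in> V" "nrm w \<le> R" and d: "d \<in> V"
    and min: "\<And>y. y \<in> V \<Longrightarrow> nrm y \<le> R \<Longrightarrow> J u \<le> J y"
    and grad: "\<And>\<epsilon>. \<epsilon> > 0 \<Longrightarrow> \<exists>\<eta>>0. \<forall>h\<in>V. nrm h < \<eta> \<longrightarrow>
        \<bar>J (\<lambda>z. u z + h z) - J u - ip d h\<bar> \<le> \<epsilon> * nrm h"
  shows "0 \<le> ip d (\<lambda>z. w z - u z)"
proof -
  let ?h = "\<lambda>z. w z - u z"
  have h: "?h \<in> V" using u w by (simp add: diff_mem)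
  have *: "- (\<epsilon> * nrm ?h) \<le> ip d ?h" if \<epsilon>: "\<epsilon> > 0" for \<epsilon>
  proof -
    obtain \<eta> where \<eta>: "\<eta> > 0" "\<And>h. h \<in> V \<Longrightarrow> nrm h < \<eta> \<Longrightarrow>
        \<bar>J (\<lambda>z. u z + h z) - J u - ip d h\<bar> \<le> \<epsilon> * nrm h"
      using grad[OF \<epsilon>] by blast
    define s where "s = min 1 (\<eta> / (nrm ?h + 1))"
    have s: "0 < s" "s \<le> 1" using \<eta>(1) nrm_nonneg[of ?h] by (auto simp: s_def)
    have "s * nrm ?h \<le> \<eta> / (nrm ?h + 1) * nrm ?h"
      by (intro mult_right_mono nrm_nonneg) (simp add: s_def)
    also have "\<dots> < \<eta>"
      using \<eta>(1) nrm_nonneg[of ?h] by (simp add: field_simps)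
    finally have "nrm (\<lambda>z. s * ?h z) < \<eta>" using s by (simp add: nrm_scale[OF h])
    from \<eta>(2)[OF scale_mem[OF h] this]
    have "\<bar>J (\<lambda>z. u z + s * ?h z) - J u - s * ip d ?h\<bar> \<le> \<epsilon> * (s * nrm ?h)"
      using s by (simp add: ip_scale_right[OF h d] nrm_scale[OF h])
    moreover have "J u \<le> J (\<lambda>z. u z + s * ?h z)"
      using s by (intro min add_mem scale_mem h u ball_convex w) auto
    ultimately have "s * (- (\<epsilon> * nrm ?h)) \<le> s * ip d ?h"
      by (simp add: algebra_simps abs_le_iff)
    then show ?thesis using s(1) by (simp only: mult_le_cancel_left_pos)
  qed
  show ?thesis
  proof (rule ccontr)
    assume "\<not> 0 \<le> ip d ?h"
    then have neg: "ip d ?h < 0" by simp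
    \<comment> \<open>Any \<open>\<epsilon>\<close> with \<open>\<epsilon> * nrm ?h < - ip d ?h\<close> would do; the added \<open>1\<close> avoids a division by zero.\<close>
    define \<epsilon> where "\<epsilon> = - ip d ?h / (2 * (nrm ?h + 1))"
    have "\<epsilon> > 0" using neg nrm_nonneg[of ?h] by (simp add: \<epsilon>_def divide_neg_pos)
    moreover have "\<epsilon> * nrm ?h < - ip d ?h"
    proof -
      have "\<epsilon> * nrm ?h \<le> \<epsilon> * (nrm ?h + 1)" using \<open>\<epsilon> > 0\<close> by simp
      also have "\<dots> = - ip d ?h / 2"
        using nrm_nonneg[of ?h] by (simp add: \<epsilon>_def field_simps)
      finally show ?thesis using neg by simp
    qed
    ultimately show False using *[of \<epsilon>] by simp
  qed
qed

end

section \<open>Inner products of weak derivatives\<close>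

definition weakly_differentiable :: "'a::euclidean_space multiset set \<Rightarrow> 'a set \<Rightarrow> ('a \<Rightarrow> real) set" where
  "weakly_differentiable B Q = {u. continuous_on (closure Q) u \<and> (\<forall>\<beta>\<in>B. \<exists>f. is_weak_deriv Q \<beta> u f)}"

text \<open>The \<open>L\<^sup>2\<close> inner product of the derivatives with index in \<open>B\<close>. All multi-indices up to order \<open>k\<close>
  give \<open>H\<^sup>k\<close>, and the empty one together with the first derivatives in space gives \<open>H\<^sup>1\<^sup>,\<^sup>0\<close>; both norms
  are thereby treated at once and compared by monotonicity in \<open>B\<close> and \<open>Q\<close>.\<close>

definition partial_inner ::
  "'a::euclidean_space multiset set \<Rightarrow> 'a set \<Rightarrow> ('a \<Rightarrow> real) \<Rightarrow> ('a \<Rightarrow> real) \<Rightarrow> real" where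
  "partial_inner B Q u w = (\<Sum>\<beta>\<in>B. LINT z:Q|lborel. weak_deriv Q \<beta> u z * weak_deriv Q \<beta> w z)"

lemma weakly_differentiable_mono:
  assumes "B' \<subseteq> B" "open Q'" "Q' \<subseteq> Q"
  shows "weakly_differentiable B Q \<subseteq> weakly_differentiable B' Q'"
proof
  fix u assume "u \<in> weakly_differentiable B Q"
  then show "u \<in> weakly_differentiable B' Q'"
    using assms is_weak_deriv_subset[OF assms(2,3)] closure_mono[OF assms(3)]
    unfolding weakly_differentiable_def by (auto intro: continuous_on_subset) blast
qed

lemma weakly_differentiable_lincomb:
  assumes Q: "open Q" "bounded Q" and B: "\<And>\<beta>. \<beta> \<in> B \<Longrightarrow> set_mset \<beta> \<subseteq> Basis"
    and u: "u \<in> weakly_differentiable B Q" and w: "w \<in> weakly_differentiable B Q"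
  shows "(\<lambda>z. p * u z + q * w z) \<in> weakly_differentiable B Q"
    and "\<beta> \<in> B \<Longrightarrow> AE z in lborel. z \<in> Q \<longrightarrow>
      weak_deriv Q \<beta> (\<lambda>z. p * u z + q * w z) z = p * weak_deriv Q \<beta> u z + q * weak_deriv Q \<beta> w z"
proof -
  have c: "continuous_on (closure Q) u" "continuous_on (closure Q) w"
    using u w by (auto simp: weakly_differentiable_def)
  then have sq: "square_integrable Q u" "square_integrable Q w"
    by (auto intro: square_integrable_continuous Q)
  have d: "is_weak_deriv Q \<beta> (\<lambda>z. p * u z + q * w z)
      (\<lambda>z. p * weak_deriv Q \<beta> u z + q * weak_deriv Q \<beta> w z)" if "\<beta> \<in> B" for \<beta>
    using u w that
    by (intro is_weak_deriv_lincomb Q B sq is_weak_deriv_weak_deriv) (auto simp: weakly_differentiable_def)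
  show "(\<lambda>z. p * u z + q * w z) \<in> weakly_differentiable B Q"
    using d c unfolding weakly_differentiable_def by (auto intro!: continuous_intros)
  show "AE z in lborel. z \<in> Q \<longrightarrow>
      weak_deriv Q \<beta> (\<lambda>z. p * u z + q * w z) z = p * weak_deriv Q \<beta> u z + q * weak_deriv Q \<beta> w z"
    if "\<beta> \<in> B"
    by (rule is_weak_deriv_unique[OF Q is_weak_deriv_weak_deriv d[OF that]])
      (use d[OF that] in blast)
qed

lemma set_integrable_imp_set_borel_measurable:
  "set_integrable M A f \<Longrightarrow> set_borel_measurable M A f"
  by (auto simp: set_integrable_def set_borel_measurable_def)

lemma partial_inner_semi_inner_product:
  assumes Q: "open Q" "bounded Q" and B: "\<And>\<beta>. \<beta> \<in> B \<Longrightarrow> set_mset \<beta> \<subseteq> Basis"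
  shows "semi_inner_product (weakly_differentiable B Q) (partial_inner B Q)"
proof
  fix u w x :: "'a \<Rightarrow> real" and p q :: real
  show "partial_inner B Q u w = partial_inner B Q w u"
    by (simp add: partial_inner_def mult.commute)
  show "0 \<le> partial_inner B Q u u"
    unfolding partial_inner_def set_lebesgue_integral_def
    by (intro sum_nonneg Bochner_Integration.integral_nonneg) auto
  assume u: "u \<in> weakly_differentiable B Q" and w: "w \<in> weakly_differentiable B Q"
  show mem: "(\<lambda>z. p * u z + q * w z) \<in> weakly_differentiable B Q"
    by (rule weakly_differentiable_lincomb(1)[OF Q _ u w]) (rule B)
  assume x: "x \<in> weakly_differentiable B Q"
  have "(LINT z:Q|lborel. weak_deriv Q \<beta> (\<lambda>z. p * u z + q * w z) z * weak_deriv Q \<beta> x z)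
      = p * (LINT z:Q|lborel. weak_deriv Q \<beta> u z * weak_deriv Q \<beta> x z)
        + q * (LINT z:Q|lborel. weak_deriv Q \<beta> w z * weak_deriv Q \<beta> x z)"
    (is "?l = _") if \<beta>: "\<beta> \<in> B" for \<beta>
  proof -
    have sq: "square_integrable Q (weak_deriv Q \<beta> y)" if "y \<in> weakly_differentiable B Q" for y
      using that \<beta> weak_deriv_square_integrable unfolding weakly_differentiable_def by blast
    note int = set_integrable_square_mult[OF sq sq]
    have lin: "AE z in lborel. z \<in> Q \<longrightarrow>
        weak_deriv Q \<beta> (\<lambda>z. p * u z + q * w z) z = p * weak_deriv Q \<beta> u z + q * weak_deriv Q \<beta> w z"
      by (rule weakly_differentiable_lincomb(2)[OF Q _ u w \<beta>]) (rule B)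
    have ints: "set_integrable lborel Q (\<lambda>z. p * (weak_deriv Q \<beta> u z * weak_deriv Q \<beta> x z))"
      "set_integrable lborel Q (\<lambda>z. q * (weak_deriv Q \<beta> w z * weak_deriv Q \<beta> x z))"
      by (intro set_integrable_mult_right int u w x)+
    have "?l = (LINT z:Q|lborel. p * (weak_deriv Q \<beta> u z * weak_deriv Q \<beta> x z)
        + q * (weak_deriv Q \<beta> w z * weak_deriv Q \<beta> x z))"
    proof (rule set_lebesgue_integral_eq_AE)
      show "AE z in lborel. z \<in> Q \<longrightarrow>
          weak_deriv Q \<beta> (\<lambda>z. p * u z + q * w z) z * weak_deriv Q \<beta> x z
          = p * (weak_deriv Q \<beta> u z * weak_deriv Q \<beta> x z) + q * (weak_deriv Q \<beta> w z * weak_deriv Q \<beta> x z)"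
        using lin by eventually_elim (simp add: algebra_simps)
    qed (intro set_integrable_imp_set_borel_measurable set_integral_add(1) ints int mem x)+
    also have "\<dots> = (LINT z:Q|lborel. p * (weak_deriv Q \<beta> u z * weak_deriv Q \<beta> x z))
        + (LINT z:Q|lborel. q * (weak_deriv Q \<beta> w z * weak_deriv Q \<beta> x z))"
      by (intro set_integral_add(2) ints)
    finally show ?thesis by simp
  qed
  then show "partial_inner B Q (\<lambda>z. p * u z + q * w z) x
      = p * partial_inner B Q u x + q * partial_inner B Q w x"
    unfolding partial_inner_def by (simp add: sum.distrib sum_distrib_left)
qed

text \<open>The weak derivative chosen on \<open>Q\<close> restricts to a weak derivative on \<open>Q'\<close>, which by uniqueness agrees
  almost everywhere with the one chosen on \<open>Q'\<close>. Then the right-hand side only has more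
  nonnegative summands and a larger domain of integration.\<close>

lemma partial_inner_mono:
  assumes Q: "open Q" "bounded Q" "open Q'" "Q' \<subseteq> Q" and B: "finite B" "B' \<subseteq> B"
    and u: "u \<in> weakly_differentiable B Q"
  shows "partial_inner B' Q' u u \<le> partial_inner B Q u u"
proof -
  have "(LINT z:Q'|lborel. weak_deriv Q' \<beta> u z * weak_deriv Q' \<beta> u z)
      \<le> (LINT z:Q|lborel. weak_deriv Q \<beta> u z * weak_deriv Q \<beta> u z)" if \<beta>: "\<beta> \<in> B'" for \<beta>
  proof -
    have ex: "\<exists>f. is_weak_deriv Q \<beta> u f" using u \<beta> B(2) unfolding weakly_differentiable_def by blast
    have d: "is_weak_deriv Q' \<beta> u (weak_deriv Q \<beta> u)"
      by (rule is_weak_deriv_subset[OF Q(3,4) is_weak_deriv_weak_deriv[OF ex]])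
    have ex': "\<exists>f. is_weak_deriv Q' \<beta> u f" using d by blast
    have bd': "bounded Q'" using Q(2,4) bounded_subset by blast
    have sq: "square_integrable Q' (weak_deriv Q' \<beta> u)" "square_integrable Q' (weak_deriv Q \<beta> u)"
      "square_integrable Q (weak_deriv Q \<beta> u)"
      using weak_deriv_square_integrable[OF ex'] d weak_deriv_square_integrable[OF ex]
      by (auto simp: is_weak_deriv_def)
    have "(LINT z:Q'|lborel. weak_deriv Q' \<beta> u z * weak_deriv Q' \<beta> u z)
        = (LINT z:Q'|lborel. weak_deriv Q \<beta> u z * weak_deriv Q \<beta> u z)"
    proof (rule set_lebesgue_integral_eq_AE)
      show "AE z in lborel. z \<in> Q' \<longrightarrow>
          weak_deriv Q' \<beta> u z * weak_deriv Q' \<beta> u z = weak_deriv Q \<beta> u z * weak_deriv Q \<beta> u z"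
        using is_weak_deriv_unique[OF Q(3) bd' is_weak_deriv_weak_deriv[OF ex'] d]
        by eventually_elim simp
    qed (intro set_integrable_imp_set_borel_measurable set_integrable_square_mult sq)+
    also have "\<dots> \<le> (LINT z:Q|lborel. weak_deriv Q \<beta> u z * weak_deriv Q \<beta> u z)"
      unfolding set_lebesgue_integral_def
      by (rule integral_mono')
        (use set_integrable_square_mult[OF sq(3,3)] Q(4) in
          \<open>auto simp: set_integrable_def split: split_indicator\<close>)
    finally show ?thesis .
  qed
  then have "partial_inner B' Q' u u \<le> partial_inner B' Q u u"
    unfolding partial_inner_def by (rule sum_mono)
  also have "\<dots> \<le> partial_inner B Q u u"
    unfolding partial_inner_def set_lebesgue_integral_def
    by (intro sum_mono2 B Bochner_Integration.integral_nonneg) auto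
  finally show ?thesis .
qed

lemma fst_mem_cylinder: "z \<in> cylinder \<Omega> s T \<Longrightarrow> fst z \<in> \<Omega>"
  by (auto simp: cylinder_def)

lemma open_cylinder: "open \<Omega> \<Longrightarrow> open (cylinder \<Omega> s T)"
  by (simp add: cylinder_def open_Times)

lemma bounded_cylinder: "bounded \<Omega> \<Longrightarrow> bounded (cylinder \<Omega> s T)"
  by (simp add: cylinder_def bounded_Times)

lemma multi_indices_Basis: "\<beta> \<in> multi_indices k \<Longrightarrow> set_mset \<beta> \<subseteq> Basis"
  by (simp add: multi_indices_def)

lemma finite_multi_indices: "finite (multi_indices k)"
proof (rule finite_subset)
  show "multi_indices k \<subseteq> mset ` {bs. set bs \<subseteq> (Basis :: 'a set) \<and> length bs \<le> k}"
  proof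
    fix \<beta> :: "'a multiset" assume "\<beta> \<in> multi_indices k"
    moreover obtain bs where "mset bs = \<beta>" using ex_mset by blast
    ultimately show "\<beta> \<in> mset ` {bs. set bs \<subseteq> Basis \<and> length bs \<le> k}"
      by (auto simp: multi_indices_def)
  qed
  show "finite (mset ` {bs. set bs \<subseteq> (Basis :: 'a set) \<and> length bs \<le> k})"
    by (intro finite_imageI finite_lists_length_le) simp
qed

lemma sobolev_eq:
  "sobolev k Q = {u \<in> weakly_differentiable (multi_indices k) Q. \<forall>z. z \<notin> closure Q \<longrightarrow> u z = 0}"
  by (auto simp: sobolev_def weakly_differentiable_def)

lemma sobolev_inner_eq: "sobolev_inner k Q = partial_inner (multi_indices k) Q"
  by (simp add: sobolev_inner_def partial_inner_def fun_eq_iff)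

text \<open>The index set of the \<open>H\<^sup>1\<^sup>,\<^sup>0\<close> norm. The empty multi-index stands for the function itself, which
  agrees with its weak derivative of order 0 almost everywhere.\<close>

definition space_indices :: "((real^'n::finite) \<times> real) multiset set" where
  "space_indices = insert {#} (range (\<lambda>i. {#dir_x i#}))"

lemma dir_x_Basis: "dir_x i \<in> Basis"
  by (simp add: dir_x_def Basis_prod_def)

lemma space_indices_Basis: "\<beta> \<in> space_indices \<Longrightarrow> set_mset \<beta> \<subseteq> Basis"
  by (auto simp: space_indices_def dir_x_Basis)

lemma space_indices_subset: "1 \<le> k \<Longrightarrow> space_indices \<subseteq> multi_indices k"
  by (auto simp: space_indices_def multi_indices_def dir_x_Basis)

lemma H10_norm_eq:
  fixes Q :: "((real^'n::finite) \<times> real) set"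
  assumes Q: "open Q" "bounded Q" and u: "u \<in> weakly_differentiable space_indices Q"
  shows "H10_norm Q u = sqrt (partial_inner space_indices Q u u)"
proof -
  let ?d = "\<lambda>\<beta> z. weak_deriv Q \<beta> u z"
  have sq: "square_integrable Q (?d \<beta>)" if "\<beta> \<in> space_indices" for \<beta>
    using u that weak_deriv_square_integrable unfolding weakly_differentiable_def by blast
  have squ: "square_integrable Q u"
    using u by (intro square_integrable_continuous Q) (auto simp: weakly_differentiable_def)
  have int: "set_integrable lborel Q (\<lambda>z. (?d {#dir_x i#} z)\<^sup>2)" for i
    using sq[of "{#dir_x i#}"] by (auto simp: space_indices_def square_integrable_def)
  have intu: "set_integrable lborel Q (\<lambda>z. (u z)\<^sup>2)"
    using squ by (simp add: square_integrable_def)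
  have ints: "set_integrable lborel Q (\<lambda>z. \<Sum>i\<in>UNIV. (?d {#dir_x i#} z)\<^sup>2)"
    and eqs: "(LINT z:Q|lborel. \<Sum>i\<in>UNIV. (?d {#dir_x i#} z)\<^sup>2)
      = (\<Sum>i\<in>UNIV. LINT z:Q|lborel. (?d {#dir_x i#} z)\<^sup>2)"
    using int unfolding set_integrable_def set_lebesgue_integral_def scaleR_sum_right
    by - (rule Bochner_Integration.integrable_sum Bochner_Integration.integral_sum, assumption)+
  have empty: "(LINT z:Q|lborel. ?d {#} z * ?d {#} z) = (LINT z:Q|lborel. (u z)\<^sup>2)"
  proof (rule set_lebesgue_integral_eq_AE)
    have e: "is_weak_deriv Q {#} u u" by (rule is_weak_deriv_empty[OF squ])
    then have "is_weak_deriv Q {#} u (?d {#})" by (intro is_weak_deriv_weak_deriv) blast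
    from is_weak_deriv_unique[OF Q this e]
    show "AE z in lborel. z \<in> Q \<longrightarrow> ?d {#} z * ?d {#} z = (u z)\<^sup>2"
      by eventually_elim (simp add: power2_eq_square)
    show "set_borel_measurable lborel Q (\<lambda>z. ?d {#} z * ?d {#} z)"
      by (intro set_integrable_imp_set_borel_measurable set_integrable_square_mult sq)
        (simp_all add: space_indices_def)
  qed (rule set_integrable_imp_set_borel_measurable[OF intu])
  have "inj (\<lambda>i::'n. {#dir_x i#})"
    by (auto simp: inj_def dir_x_def axis_eq_axis)
  then have "partial_inner space_indices Q u u
      = (LINT z:Q|lborel. ?d {#} z * ?d {#} z)
        + (\<Sum>i\<in>UNIV. LINT z:Q|lborel. ?d {#dir_x i#} z * ?d {#dir_x i#} z)"
    unfolding partial_inner_def space_indices_def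
    by (subst sum.insert) (auto simp: sum.reindex)
  also have "\<dots> = (LINT z:Q|lborel. (\<Sum>i\<in>UNIV. (?d {#dir_x i#} z)\<^sup>2) + (u z)\<^sup>2)"
    using ints intu eqs by (simp add: empty power2_eq_square)
  finally show ?thesis by (simp add: H10_norm_def)
qed

lemma sobolev_norm_eq:
  "sobolev_norm k Q u = sqrt (partial_inner (multi_indices k) Q u u)"
  by (simp add: sobolev_norm_def sobolev_inner_eq)

lemma H0_lincomb:
  assumes \<Omega>: "open \<Omega>" "bounded \<Omega>" and u: "u \<in> H0 k \<Omega> T" "w \<in> H0 k \<Omega> T"
  shows "(\<lambda>z. p * u z + q * w z) \<in> H0 k \<Omega> T"
proof -
  have "(\<lambda>z. p * u z + q * w z) \<in> weakly_differentiable (multi_indices k) (QT \<Omega> T)"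
    using u by (intro weakly_differentiable_lincomb(1) open_cylinder bounded_cylinder \<Omega> multi_indices_Basis)
      (auto simp: H0_def sobolev_eq)
  then show ?thesis using u by (simp add: H0_def sobolev_eq)
qed

lemma H0_semi_inner_product:
  assumes \<Omega>: "open \<Omega>" "bounded \<Omega>"
  shows "semi_inner_product (H0 k \<Omega> T) (sobolev_inner k (QT \<Omega> T))"
  unfolding sobolev_inner_eq
proof (rule semi_inner_product.subspace[OF partial_inner_semi_inner_product])
  show "H0 k \<Omega> T \<subseteq> weakly_differentiable (multi_indices k) (QT \<Omega> T)"
    by (auto simp: H0_def sobolev_eq)
qed (use \<Omega> in \<open>auto intro: open_cylinder bounded_cylinder H0_lincomb dest: multi_indices_Basis\<close>)

lemma H0_weakly_differentiableerentiable_space: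
  assumes "open \<Omega>" "0 \<le> \<tau>" "1 \<le> k"
  shows "H0 k \<Omega> T \<subseteq> weakly_differentiable space_indices (cylinder \<Omega> \<tau> T)"
proof -
  have "weakly_differentiable (multi_indices k) (QT \<Omega> T) \<subseteq> weakly_differentiable space_indices (cylinder \<Omega> \<tau> T)"
    using assms by (intro weakly_differentiable_mono space_indices_subset open_cylinder) (auto simp: cylinder_def)
  then show ?thesis by (auto simp: H0_def sobolev_eq)
qed

lemma H10_norm_le_sobolev_norm:
  assumes \<Omega>: "open \<Omega>" "bounded \<Omega>" and "0 \<le> \<tau>" "1 \<le> k" and u: "u \<in> H0 k \<Omega> T"
  shows "H10_norm (cylinder \<Omega> \<tau> T) u \<le> sobolev_norm k (QT \<Omega> T) u"
proof -
  have "u \<in> weakly_differentiable space_indices (cylinder \<Omega> \<tau> T)"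
    using H0_weakly_differentiableerentiable_space assms by blast
  then have "H10_norm (cylinder \<Omega> \<tau> T) u = sqrt (partial_inner space_indices (cylinder \<Omega> \<tau> T) u u)"
    by (intro H10_norm_eq open_cylinder bounded_cylinder \<Omega>)
  also have "\<dots> \<le> sobolev_norm k (QT \<Omega> T) u"
    unfolding sobolev_norm_eq using u assms
    by (intro real_sqrt_le_mono partial_inner_mono open_cylinder bounded_cylinder \<Omega>
        finite_multi_indices space_indices_subset)
      (auto simp: H0_def sobolev_eq cylinder_def)
  finally show ?thesis .
qed

lemma H10_norm_diff_triangle:
  assumes \<Omega>: "open \<Omega>" "bounded \<Omega>" and "0 \<le> \<tau>" "1 \<le> k"
    and u: "u \<in> H0 k \<Omega> T" "w \<in> H0 k \<Omega> T" "x \<in> H0 k \<Omega> T"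
  shows "H10_norm (cylinder \<Omega> \<tau> T) (\<lambda>z. u z - x z)
    \<le> H10_norm (cylinder \<Omega> \<tau> T) (\<lambda>z. u z - w z) + H10_norm (cylinder \<Omega> \<tau> T) (\<lambda>z. w z - x z)"
proof -
  let ?Q = "cylinder \<Omega> \<tau> T"
  have Q: "open ?Q" "bounded ?Q" using \<Omega> by (auto intro: open_cylinder bounded_cylinder)
  interpret semi_inner_product "weakly_differentiable space_indices ?Q" "partial_inner space_indices ?Q"
    by (rule partial_inner_semi_inner_product[OF Q space_indices_Basis])
  have "u \<in> weakly_differentiable space_indices ?Q" "w \<in> weakly_differentiable space_indices ?Q"
    "x \<in> weakly_differentiable space_indices ?Q"
    using u H0_weakly_differentiableerentiable_space[of \<Omega> \<tau> k T] assms by auto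
  then show ?thesis
    using nrm_diff_triangle[of u w x] diff_mem by (simp add: nrm_def H10_norm_eq[OF Q])
qed

section \<open>The choice of the parameters\<close>

text \<open>The choice of \<open>\<nu>\<close> amounts to \<open>\<nu> ln (T + 1) = ln X\<close> with \<open>X = ln (1/\<delta>) / 2\<close>. Hence \<open>(s + 1) powr \<nu>\<close> is
  the power of \<open>X\<close> with exponent \<open>ln (s + 1) / ln (T + 1)\<close>.\<close>

lemma powr_nu_of:
  assumes "0 < s" "0 < T" "0 < \<delta>" "\<delta> < 1"
  shows "(s + 1) powr nu_of T \<delta> = 1 / 2 powr rate_exponent s T * ln (1 / \<delta>) powr rate_exponent s T"
proof -
  have l: "ln (1 / \<delta>) > 0" using assms by simp
  have X: "ln (\<delta> powr (- 1 / 2)) = ln (1 / \<delta>) / 2"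
    using assms by (simp add: ln_powr ln_div)
  have "nu_of T \<delta> = ln (ln (1 / \<delta>) / 2) / ln (T + 1)"
    unfolding nu_of_def X using l by (simp add: ln_powr)
  then have "(s + 1) powr nu_of T \<delta> = (ln (1 / \<delta>) / 2) powr rate_exponent s T"
    using assms l by (simp add: powr_def rate_exponent_def mult.commute)
  also have "\<dots> = 1 / 2 powr rate_exponent s T * ln (1 / \<delta>) powr rate_exponent s T"
    using l by (subst powr_divide) auto
  finally show ?thesis .
qed

text \<open>The two uses of the choice of \<open>\<nu>\<close>: at \<open>s = \<tau>\<close>, the factor in front of the integral in the functional
  is the square of the claimed rate; at \<open>s = T\<close>, where the exponent is \<open>1\<close>, the bound for the
  weight in the integral is \<open>1/\<delta>\<close>, which the square of the noise level outweighs.\<close>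

lemma exp_powr_nu_of:
  assumes "0 < T" "0 < \<delta>" "\<delta> < 1"
  shows "0 < \<tau> \<Longrightarrow> exp (- 2 * (\<tau> + 1) powr nu_of T \<delta>) = (error_rate (rate_exponent \<tau> T) \<delta>)\<^sup>2"
    and "exp (2 * (T + 1) powr nu_of T \<delta>) = 1 / \<delta>"
proof -
  show "exp (- 2 * (\<tau> + 1) powr nu_of T \<delta>) = (error_rate (rate_exponent \<tau> T) \<delta>)\<^sup>2" if "0 < \<tau>"
    using powr_nu_of[OF that assms]
    by (simp add: error_rate_def power2_eq_square flip: exp_add)
  have "rate_exponent T T = 1" using assms by (simp add: rate_exponent_def)
  then have "2 * (T + 1) powr nu_of T \<delta> = ln (1 / \<delta>)"
    using powr_nu_of[OF assms(1,1,2,3)] assms by simp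
  then show "exp (2 * (T + 1) powr nu_of T \<delta>) = 1 / \<delta>"
    using assms by simp
qed

lemma nu_of_antimono:
  assumes "0 < T" "0 < \<delta>" "\<delta> \<le> \<delta>'" "\<delta>' < 1"
  shows "nu_of T \<delta>' \<le> nu_of T \<delta>"
proof -
  have "ln (\<delta>' powr (- 1 / 2)) \<le> ln (\<delta> powr (- 1 / 2))"
    using assms by (simp add: ln_powr)
  moreover have "ln (\<delta>' powr (- 1 / 2)) > 0"
    using assms by (simp add: ln_powr)
  ultimately show ?thesis
    unfolding nu_of_def using assms by (simp add: ln_powr divide_right_mono)
qed

lemma rate_exponent_bounds:
  assumes "0 < \<tau>" "\<tau> < T"
  shows "rate_exponent \<tau> T \<in> {0<..<1}"
  using assms by (auto simp: rate_exponent_def)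

section \<open>The effect of the data error on the equation\<close>

text \<open>The supremum in \<open>C_norm\<close> bounds the derivatives only if the set of their values is bounded above.\<close>

definition derivs_bounded :: "nat \<Rightarrow> 'a::euclidean_space set \<Rightarrow> ('a \<Rightarrow> real) \<Rightarrow> bool" where
  "derivs_bounded m S u \<longleftrightarrow>
     (\<exists>K. \<forall>bs z. set bs \<subseteq> Basis \<and> length bs \<le> m \<and> z \<in> S \<longrightarrow> \<bar>iter_partial bs u z\<bar> \<le> K)"

lemma abs_le_C_norm:
  assumes "derivs_bounded m S u" "set bs \<subseteq> Basis" "length bs \<le> m" "z \<in> S"
  shows "\<bar>iter_partial bs u z\<bar> \<le> C_norm m S u"
  unfolding C_norm_def
proof (rule cSup_upper)
  show "bdd_above {\<bar>iter_partial bs u z\<bar> |bs z. set bs \<subseteq> Basis \<and> length bs \<le> m \<and> z \<in> S}"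
    using assms(1) unfolding derivs_bounded_def bdd_above_def by blast
qed (use assms in blast)

lemma C_closed_derivs_bounded:
  assumes u: "C_closed m S u" and S: "bounded S"
  shows "derivs_bounded m S u"
proof -
  have "\<exists>K. \<forall>z\<in>S. \<bar>iter_partial bs u z\<bar> \<le> K" if bs: "set bs \<subseteq> Basis" "length bs \<le> m" for bs
  proof -
    obtain w where w: "continuous_on (closure S) w" "\<And>z. z \<in> S \<Longrightarrow> w z = iter_partial bs u z"
      using u bs unfolding C_closed_def by metis
    have "bounded (w ` closure S)"
      using S w(1) by (intro compact_imp_bounded compact_continuous_image) auto
    then obtain K where "\<And>z. z \<in> closure S \<Longrightarrow> \<bar>w z\<bar> \<le> K"
      by (auto simp: bounded_iff)
    then show ?thesis using w(2) closure_subset by (metis subsetD)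
  qed
  then obtain K where K: "\<And>bs z. set bs \<subseteq> Basis \<Longrightarrow> length bs \<le> m \<Longrightarrow> z \<in> S \<Longrightarrow>
      \<bar>iter_partial bs u z\<bar> \<le> K bs"
    by metis
  let ?L = "{bs :: 'a list. set bs \<subseteq> Basis \<and> length bs \<le> m}"
  have fin: "finite ?L" by (rule finite_lists_length_le) simp
  have "\<bar>iter_partial bs u z\<bar> \<le> Max (K ` ?L)" if "set bs \<subseteq> Basis" "length bs \<le> m" "z \<in> S" for bs z
  proof -
    have "K bs \<le> Max (K ` ?L)" using fin that by (intro Max_ge) auto
    then show ?thesis using K[OF that] by linarith
  qed
  then show ?thesis unfolding derivs_bounded_def by blast
qed

lemma iter_partial_diff:
  assumes "open S" "C_open m S u" "C_open m S w"
    and "set bs \<subseteq> Basis" "length bs \<le> m" "z \<in> S"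
  shows "iter_partial bs (\<lambda>x. u x - w x) z = iter_partial bs u z - iter_partial bs w z"
  using assms(4-6)
proof (induction bs arbitrary: z)
  case (Cons b bs)
  let ?f = "\<lambda>v s::real. iter_partial bs v (z + s *\<^sub>R b)"
  have "?f u differentiable (at 0)" "?f w differentiable (at 0)"
    using assms(2,3) Cons.prems unfolding C_open_def by auto
  then obtain p q where pq: "(?f u has_field_derivative p) (at 0)" "(?f w has_field_derivative q) (at 0)"
    unfolding real_differentiable_def by blast
  have "(?f (\<lambda>x. u x - w x) has_field_derivative p - q) (at 0)"
  proof (rule has_field_derivative_transform_within_open[OF DERIV_diff[OF pq]])
    show "open ((\<lambda>s::real. z + s *\<^sub>R b) -` S)"
      by (intro open_vimage continuous_intros assms(1))
  qed (use Cons in auto)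
  then show ?case
    using pq by (simp add: partial_def DERIV_imp_deriv)
qed simp

lemma derivs_bounded_diff:
  assumes "open S" "bounded S" "C_closed m S u" "C_closed m S w"
  shows "derivs_bounded m S (\<lambda>x. u x - w x)"
proof -
  obtain K L where
    K: "\<And>bs z. set bs \<subseteq> Basis \<Longrightarrow> length bs \<le> m \<Longrightarrow> z \<in> S \<Longrightarrow> \<bar>iter_partial bs u z\<bar> \<le> K" and
    L: "\<And>bs z. set bs \<subseteq> Basis \<Longrightarrow> length bs \<le> m \<Longrightarrow> z \<in> S \<Longrightarrow> \<bar>iter_partial bs w z\<bar> \<le> L"
    using C_closed_derivs_bounded[OF assms(3,2)] C_closed_derivs_bounded[OF assms(4,2)]
    unfolding derivs_bounded_def by meson
  have "\<bar>iter_partial bs (\<lambda>x. u x - w x) z\<bar> \<le> K + L"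
    if "set bs \<subseteq> Basis" "length bs \<le> m" "z \<in> S" for bs z
    using K[OF that] L[OF that] assms
      iter_partial_diff[OF assms(1) _ _ that, of u w] by (auto simp: C_closed_def)
  then show ?thesis unfolding derivs_bounded_def by blast
qed

lemma abs_iter_partial_diff_le_C_norm:
  assumes "open S" "bounded S" "C_closed m S u" "C_closed m S w"
    and "set bs \<subseteq> Basis" "length bs \<le> m" "z \<in> S"
  shows "\<bar>iter_partial bs u z - iter_partial bs w z\<bar> \<le> C_norm m S (\<lambda>x. u x - w x)"
proof -
  have "C_open m S u" "C_open m S w" using assms by (auto simp: C_closed_def)
  from iter_partial_diff[OF assms(1) this assms(5-7)] show ?thesis
    using abs_le_C_norm[OF derivs_bounded_diff[OF assms(1-4)] assms(5-7)] by simp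
qed

text \<open>By this the space derivatives of \<open>g \<circ> fst\<close>, as they occur in the equation, become those of \<open>g\<close>,
  which the \<open>C\<^sup>2\<close> norm controls.\<close>

lemma partial_dir_x_comp_fst: "partial (dir_x i) (h \<circ> fst) = partial (axis i 1) h \<circ> fst"
  by (simp add: partial_def dir_x_def fun_eq_iff comp_def)

lemma coefficient_bound:
  assumes "coefficients \<Omega> T \<mu>1 \<mu>2 M a" "bounded \<Omega>" "z \<in> QT \<Omega> T"
  shows "\<bar>a i j z\<bar> \<le> \<bar>M\<bar>"
proof -
  have "derivs_bounded 1 (QT \<Omega> T) (a i j)"
    using assms by (intro C_closed_derivs_bounded bounded_cylinder) (auto simp: coefficients_def)
  from abs_le_C_norm[OF this, of "[]" z]
  have "\<bar>a i j z\<bar> \<le> C_norm 1 (QT \<Omega> T) (a i j)" using assms by simp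
  also have "{C_norm 1 (QT \<Omega> T) (a i j) |i j. True} = (\<lambda>(i, j). C_norm 1 (QT \<Omega> T) (a i j)) ` UNIV"
    by auto
  then have "C_norm 1 (QT \<Omega> T) (a i j) \<le> M"
    using assms(1) unfolding coefficients_def by (auto intro!: Max_ge)
  finally show ?thesis by simp
qed

text \<open>The data enter through \<open>L g\<close>, with coefficients bounded by \<open>M\<close>, and through the arguments of the
  Lipschitz function \<open>F\<close>; both depend on derivatives of \<open>g\<close> up to order 2. The \<open>n\<^sup>2\<close> counts the second
  derivatives, the \<open>n + 1\<close> the components of gradient and value.\<close>

lemma op_G_data_error:
  fixes \<Omega> :: "(real^'n::finite) set"
  assumes \<Omega>: "open \<Omega>" "bounded \<Omega>" and a: "coefficients \<Omega> T \<mu>1 \<mu>2 M a"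
    and F: "nonlinearity C F"
    and g: "C_closed 2 \<Omega> g" "C_closed 2 \<Omega> g'"
    and \<delta>: "C_norm 2 \<Omega> (\<lambda>x. g x - g' x) \<le> \<delta>" and z: "z \<in> QT \<Omega> T"
  shows "\<bar>op_G a F g v z - op_G a F g' v z\<bar>
    \<le> ((real CARD('n))\<^sup>2 * \<bar>M\<bar> + C * (real CARD('n) + 1)) * \<delta>"
proof -
  let ?n = "real CARD('n)"
  have C: "0 \<le> C" using F unfolding nonlinearity_def by (auto dest: lipschitz_on_nonneg)
  have d: "\<bar>iter_partial bs g (fst z) - iter_partial bs g' (fst z)\<bar> \<le> \<delta>"
    if "set bs \<subseteq> Basis" "length bs \<le> 2" for bs
    using abs_iter_partial_diff_le_C_norm[OF \<Omega> g that] fst_mem_cylinder[OF z] \<delta> by fastforce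
  have ax: "axis i 1 \<in> (Basis :: (real^'n) set)" for i by simp
  have "\<bar>op_L a (g \<circ> fst) z - op_L a (g' \<circ> fst) z\<bar> \<le> (\<Sum>i\<in>(UNIV::'n set). \<Sum>j\<in>(UNIV::'n set). \<bar>M\<bar> * \<delta>)"
  proof -
    have "op_L a (g \<circ> fst) z - op_L a (g' \<circ> fst) z
        = (\<Sum>i\<in>UNIV. \<Sum>j\<in>UNIV. a i j z * (iter_partial [axis j 1, axis i 1] g (fst z)
              - iter_partial [axis j 1, axis i 1] g' (fst z)))"
      unfolding op_L_def
      by (simp add: partial_dir_x_comp_fst sum_subtractf right_diff_distrib)
    also have "\<bar>\<dots>\<bar> \<le> (\<Sum>i\<in>UNIV. \<Sum>j\<in>UNIV. \<bar>a i j z * (iter_partial [axis j 1, axis i 1] g (fst z)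
              - iter_partial [axis j 1, axis i 1] g' (fst z))\<bar>)"
      by (intro order_trans[OF sum_abs] sum_mono sum_abs)
    also have "\<dots> \<le> (\<Sum>i\<in>(UNIV::'n set). \<Sum>j\<in>(UNIV::'n set). \<bar>M\<bar> * \<delta>)"
      unfolding abs_mult
      by (intro sum_mono mult_mono coefficient_bound[OF a \<Omega>(2) z] d) (auto simp: ax)
    finally show ?thesis .
  qed
  then have L: "\<bar>op_L a (g \<circ> fst) z - op_L a (g' \<circ> fst) z\<bar> \<le> ?n\<^sup>2 * \<bar>M\<bar> * \<delta>"
    by (simp add: power2_eq_square mult.assoc)
  let ?y = "\<lambda>g. (grad_x v z + grad_x (g \<circ> fst) z, v z + g (fst z), fst z, snd z)"
  have "dist (?y g) (?y g') \<le> norm (grad_x (g \<circ> fst) z - grad_x (g' \<circ> fst) z) + \<bar>g (fst z) - g' (fst z)\<bar>"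
    using sqrt_sum_squares_le_sum_abs[of "norm (grad_x (g \<circ> fst) z - grad_x (g' \<circ> fst) z)" "g (fst z) - g' (fst z)"]
    by (simp add: dist_norm norm_Pair)
  also have "\<dots> \<le> ?n * \<delta> + \<delta>"
  proof (rule add_mono)
    show "\<bar>g (fst z) - g' (fst z)\<bar> \<le> \<delta>" using d[of "[]"] by simp
    have "norm (grad_x (g \<circ> fst) z - grad_x (g' \<circ> fst) z)
        \<le> (\<Sum>i\<in>UNIV. \<bar>(grad_x (g \<circ> fst) z - grad_x (g' \<circ> fst) z) $ i\<bar>)"
      by (rule norm_le_l1_cart)
    also have "\<dots> \<le> (\<Sum>i\<in>(UNIV::'n set). \<delta>)"
    proof (rule sum_mono)
      fix i :: 'n
      show "\<bar>(grad_x (g \<circ> fst) z - grad_x (g' \<circ> fst) z) $ i\<bar> \<le> \<delta>"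
        using d[of "[axis i 1]"] by (simp add: grad_x_def partial_dir_x_comp_fst ax)
    qed
    finally show "norm (grad_x (g \<circ> fst) z - grad_x (g' \<circ> fst) z) \<le> ?n * \<delta>" by simp
  qed
  finally have "C * dist (?y g) (?y g') \<le> C * (?n * \<delta> + \<delta>)"
    using C by (rule mult_left_mono)
  moreover have "dist (F (?y g)) (F (?y g')) \<le> C * dist (?y g) (?y g')"
    using F unfolding nonlinearity_def by (auto intro: lipschitz_onD)
  ultimately have "\<bar>F (?y g) - F (?y g')\<bar> \<le> C * (?n * \<delta> + \<delta>)"
    by (simp add: dist_real_def)
  with L show ?thesis
    unfolding op_G_def by (simp add: algebra_simps)
qed

section \<open>Gradient projection and error estimate\<close>

lemma B_open_subset_B_closed: "B_open k \<Omega> T R \<subseteq> B_closed k \<Omega> T R"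
  by (auto simp: B_open_def B_closed_def)

lemma proj_B_mem:
  assumes \<Omega>: "open \<Omega>" "bounded \<Omega>" and v: "v \<in> H0 k \<Omega> T" and R: "0 \<le> R"
  shows "proj_B k \<Omega> T R v \<in> B_closed k \<Omega> T R"
proof -
  interpret semi_inner_product "H0 k \<Omega> T" "sobolev_inner k (QT \<Omega> T)"
    by (rule H0_semi_inner_product[OF \<Omega>])
  have nrm: "nrm = sobolev_norm k (QT \<Omega> T)"
    by (simp add: fun_eq_iff nrm_def sobolev_norm_def)
  have "\<exists>w. w \<in> B_closed k \<Omega> T R \<and> (\<forall>y\<in>B_closed k \<Omega> T R.
        sobolev_norm k (QT \<Omega> T) (\<lambda>z. v z - w z) \<le> sobolev_norm k (QT \<Omega> T) (\<lambda>z. v z - y z))"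
    using ball_projection_exists[OF v R] unfolding nrm B_closed_def by blast
  then show ?thesis
    unfolding proj_B_def by (rule someI2_ex) blast
qed

text \<open>Every gradient step taken from the ball stays in \<open>H\<^sub>0\<^sup>k\<close>, where the projection exists and returns it to the
  ball.\<close>

lemma gradient_projection_mem:
  assumes \<Omega>: "open \<Omega>" "bounded \<Omega>" and R: "0 \<le> R" and v0: "v0 \<in> B_closed k \<Omega> T R"
    and grad: "\<And>v. v \<in> B_closed k \<Omega> T R \<Longrightarrow> frechet_grad k \<Omega> T J v \<in> H0 k \<Omega> T"
  shows "gradient_projection k \<Omega> T R J \<gamma> v0 m \<in> B_closed k \<Omega> T R"
proof (induction m)
  case (Suc m)
  let ?v = "gradient_projection k \<Omega> T R J \<gamma> v0 m"
  have "(\<lambda>z. 1 * ?v z + (- \<gamma>) * frechet_grad k \<Omega> T J ?v z) \<in> H0 k \<Omega> T"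
    using Suc grad by (intro H0_lincomb \<Omega>) (auto simp: B_closed_def)
  then show ?case
    using proj_B_mem[OF \<Omega> _ R] by simp
qed (simp add: v0)

lemma frechet_grad_is_frechet_grad:
  "\<exists>d. is_frechet_grad k \<Omega> T J v d \<Longrightarrow> is_frechet_grad k \<Omega> T J v (frechet_grad k \<Omega> T J v)"
  unfolding frechet_grad_def by (rule someI_ex[where P = "is_frechet_grad k \<Omega> T J v"])

lemma minimizer_variational_inequality:
  assumes \<Omega>: "open \<Omega>" "bounded \<Omega>" and min: "unique_minimizer J (B_closed k \<Omega> T R) u"
    and w: "w \<in> B_closed k \<Omega> T R" and d: "is_frechet_grad k \<Omega> T J u d"
  shows "0 \<le> sobolev_inner k (QT \<Omega> T) d (\<lambda>z. w z - u z)"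
proof -
  interpret semi_inner_product "H0 k \<Omega> T" "sobolev_inner k (QT \<Omega> T)"
    by (rule H0_semi_inner_product[OF \<Omega>])
  have nrm: "nrm = sobolev_norm k (QT \<Omega> T)"
    by (simp add: fun_eq_iff nrm_def sobolev_norm_def)
  have "u \<in> H0 k \<Omega> T" "nrm u \<le> R" "w \<in> H0 k \<Omega> T" "nrm w \<le> R"
    using min w by (auto simp: unique_minimizer_def B_closed_def nrm)
  moreover have "d \<in> H0 k \<Omega> T" using d by (simp add: is_frechet_grad_def)
  moreover have "J u \<le> J y" if "y \<in> H0 k \<Omega> T" "nrm y \<le> R" for y
    using min that unfolding unique_minimizer_def B_closed_def nrm by fastforce
  moreover have "\<exists>\<eta>>0. \<forall>h\<in>H0 k \<Omega> T. nrm h < \<eta> \<longrightarrow>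
      \<bar>J (\<lambda>z. u z + h z) - J u - sobolev_inner k (QT \<Omega> T) d h\<bar> \<le> \<epsilon> * nrm h" if "\<epsilon> > 0" for \<epsilon>
    using d[unfolded is_frechet_grad_def, THEN conjunct2, rule_format, OF that]
    unfolding nrm by simp
  ultimately show ?thesis
    by (rule variational_inequality[where J = J and R = R])
qed

lemma tikhonov_nonneg:
  assumes "0 \<le> \<alpha>"
  shows "0 \<le> tikhonov k \<Omega> T \<tau> a F g \<alpha> \<nu> v"
  unfolding tikhonov_def set_lebesgue_integral_def
  using assms by (intro add_nonneg_nonneg mult_nonneg_nonneg Bochner_Integration.integral_nonneg) auto

text \<open>If \<open>f\<close> is not integrable, its integral is \<open>0\<close> by convention, which satisfies the bound as well since \<open>K\<close>
  is nonnegative.\<close>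

lemma set_lebesgue_integral_le_const:
  fixes f :: "'a::euclidean_space \<Rightarrow> real"
  assumes "open Q" "bounded Q" and f: "\<And>z. z \<in> Q \<Longrightarrow> f z \<le> K" and "0 \<le> K"
  shows "(LINT z:Q|lborel. f z) \<le> K * measure lborel Q"
proof -
  have "emeasure lborel Q < \<infinity>" by (rule emeasure_bounded_finite[OF assms(2)])
  then have int: "integrable lborel (\<lambda>z. K * indicator Q z)"
    using assms(1) by (intro integrable_mult_right integrable_real_indicator) auto
  have "(LINT z:Q|lborel. f z) \<le> (\<integral>z. K * indicator Q z \<partial>lborel)"
    unfolding set_lebesgue_integral_def
    using int by (rule integral_mono') (use f \<open>0 \<le> K\<close> in \<open>auto split: split_indicator\<close>)
  then show ?thesis by simp
qed

text \<open>Substituting the equation for \<open>vs\<close>, the residual becomes the difference of \<open>op_G\<close> for the exact and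
  the noisy data, of size \<open>K \<delta>\<close>. The weight is at most \<open>1/\<delta>\<close>, so the integrand is at most
  \<open>K\<^sup>2 \<delta> \<le> K\<^sup>2\<close>.\<close>

lemma tikhonov_exact_solution_bound:
  fixes \<Omega> :: "(real^'n::finite) set"
  assumes \<Omega>: "open \<Omega>" "bounded \<Omega>" and T: "0 < T" and \<tau>: "0 < \<tau>"
    and a: "coefficients \<Omega> T \<mu>1 \<mu>2 M a" and F: "nonlinearity C F"
    and g: "C_closed 2 \<Omega> gs" "C_closed 2 \<Omega> g"
    and noise: "C_norm 2 \<Omega> (\<lambda>x. g x - gs x) \<le> \<delta>" and \<delta>: "0 < \<delta>" "\<delta> < 1"
    and vs: "exact_solution \<Omega> T a F gs vs" and nu: "0 \<le> nu_of T \<delta>"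
    and K: "K = (real CARD('n))\<^sup>2 * \<bar>M\<bar> + C * (real CARD('n) + 1)"
  shows "tikhonov k \<Omega> T \<tau> a F g \<alpha> (nu_of T \<delta>) vs
    \<le> (error_rate (rate_exponent \<tau> T) \<delta>)\<^sup>2 * (K\<^sup>2 * measure lborel (QT \<Omega> T))
      + \<alpha> * (sobolev_norm k (QT \<Omega> T) vs)\<^sup>2"
proof -
  let ?\<nu> = "nu_of T \<delta>"
  have C: "0 \<le> C" using F unfolding nonlinearity_def by (auto dest: lipschitz_on_nonneg)
  have K0: "0 \<le> K" unfolding K using C by simp
  have "(partial dir_t vs z - op_L a vs z - op_G a F g vs z)\<^sup>2 * exp (2 * (snd z + 1) powr ?\<nu>) \<le> K\<^sup>2"
    (is "?r\<^sup>2 * ?e \<le> _") if z: "z \<in> QT \<Omega> T" for z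
  proof -
    have "?r = op_G a F gs vs z - op_G a F g vs z"
      using vs z unfolding exact_solution_def by auto
    then have "\<bar>?r\<bar> \<le> K * \<delta>"
      using op_G_data_error[OF \<Omega> a F g(2,1) noise z, of vs] by (simp add: K abs_minus_commute)
    then have "?r\<^sup>2 \<le> (K * \<delta>)\<^sup>2"
      by (metis abs_ge_zero power2_abs power_mono)
    moreover have "?e \<le> exp (2 * (T + 1) powr ?\<nu>)"
      using z nu by (auto simp: cylinder_def intro!: powr_mono2)
    then have "?e \<le> 1 / \<delta>"
      by (simp only: exp_powr_nu_of(2)[OF T \<delta>])
    ultimately have "?r\<^sup>2 * ?e \<le> (K * \<delta>)\<^sup>2 * (1 / \<delta>)"
      by (intro mult_mono) auto
    also have "\<dots> = K\<^sup>2 * \<delta>" using \<delta> by (simp add: power2_eq_square)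
    also have "\<dots> \<le> K\<^sup>2 * 1" using \<delta> by (intro mult_left_mono) auto
    finally show ?thesis by simp
  qed
  then have "(LINT z:QT \<Omega> T|lborel. (partial dir_t vs z - op_L a vs z - op_G a F g vs z)\<^sup>2
      * exp (2 * (snd z + 1) powr ?\<nu>)) \<le> K\<^sup>2 * measure lborel (QT \<Omega> T)"
    by (intro set_lebesgue_integral_le_const open_cylinder bounded_cylinder \<Omega>) auto
  then show ?thesis
    unfolding tikhonov_def exp_powr_nu_of(1)[OF T \<delta> \<tau>]
    by (intro add_mono mult_left_mono[of _ _ "_\<^sup>2"] order_refl) auto
qed

text \<open>Strict convexity is applied at the minimizer \<open>vmin\<close> with the exact solution \<open>vs\<close> as second point. Its
  left-hand side is at most \<open>J vs\<close>, because \<open>J vmin\<close> is nonnegative and so is the derivative term, by the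
  variational inequality. Both parts of \<open>J vs\<close> carry the squared rate: the integral by
  \<open>tikhonov_exact_solution_bound\<close>, and the penalty because \<open>\<alpha>\<close> is \<open>2 * C2\<close> times the squared rate. The first conclusion records the
  existence of gradients that strict convexity provides for this functional.\<close>

lemma minimizer_error_estimate:
  fixes \<Omega> :: "(real^'n::finite) set"
  assumes \<Omega>: "open \<Omega>" "bounded \<Omega>" and T: "0 < T" and \<tau>: "0 < \<tau>" and R: "0 < R" and C2: "0 < C2"
    and a: "coefficients \<Omega> T \<mu>1 \<mu>2 M a" and F: "nonlinearity C F"
    and g: "C_closed 2 \<Omega> gs" "C_closed 2 \<Omega> g"
    and noise: "C_norm 2 \<Omega> (\<lambda>x. g x - gs x) \<le> \<delta>" and \<delta>: "0 < \<delta>" "\<delta> < 1"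
    and vs: "exact_solution \<Omega> T a F gs vs" "vs \<in> B_closed k \<Omega> T R"
    and \<nu>3: "0 \<le> \<nu>3" "\<nu>3 \<le> nu_of T \<delta>"
    and conv: "strict_convexity_property k \<Omega> T \<tau> R a F g \<nu>3 C2"
    and J: "J = tikhonov k \<Omega> T \<tau> a F g (alpha_of T \<tau> C2 \<delta>) (nu_of T \<delta>)"
    and K: "K = (real CARD('n))\<^sup>2 * \<bar>M\<bar> + C * (real CARD('n) + 1)"
  shows "\<And>v. v \<in> B_closed k \<Omega> T R \<Longrightarrow> is_frechet_grad k \<Omega> T J v (frechet_grad k \<Omega> T J v)"
    and "\<And>vmin. unique_minimizer J (B_closed k \<Omega> T R) vmin \<Longrightarrow>
      H10_norm (cylinder \<Omega> \<tau> T) (\<lambda>z. vs z - vmin z)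
      \<le> sqrt ((K\<^sup>2 * measure lborel (QT \<Omega> T) + 2 * C2 * R\<^sup>2) / C2)
        * error_rate (rate_exponent \<tau> T) \<delta>"
proof -
  let ?\<alpha> = "alpha_of T \<tau> C2 \<delta>" and ?e = "error_rate (rate_exponent \<tau> T) \<delta>"
  have "?\<alpha> \<in> {0<..<1}"
    using conv \<nu>3 unfolding strict_convexity_property_def alpha_of_def by blast
  then have \<alpha>: "0 < ?\<alpha>" "?\<alpha> \<in> {2 * C2 * exp (- 2 * (\<tau> + 1) powr nu_of T \<delta>)..<1}"
    by (auto simp: alpha_of_def)
  have *: "(\<exists>d. is_frechet_grad k \<Omega> T J v1 d) \<and>
      (\<forall>v2\<in>B_closed k \<Omega> T R.
        J v2 - J v1 - sobolev_inner k (QT \<Omega> T) (frechet_grad k \<Omega> T J v1) (\<lambda>z. v2 z - v1 z)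
        \<ge> C2 * (H10_norm (cylinder \<Omega> \<tau> T) (\<lambda>z. v2 z - v1 z))\<^sup>2
          + ?\<alpha> / 2 * (sobolev_norm k (QT \<Omega> T) (\<lambda>z. v2 z - v1 z))\<^sup>2)"
    if "v1 \<in> B_closed k \<Omega> T R" for v1
    using conv[unfolded strict_convexity_property_def Let_def, rule_format, OF \<nu>3(2),
        THEN conjunct2, rule_format, OF \<alpha>(2) that] unfolding J .
  show grad: "is_frechet_grad k \<Omega> T J v (frechet_grad k \<Omega> T J v)" if "v \<in> B_closed k \<Omega> T R" for v
    using *[OF that] by (intro frechet_grad_is_frechet_grad) blast
  fix vmin assume min: "unique_minimizer J (B_closed k \<Omega> T R) vmin"
  then have mem: "vmin \<in> B_closed k \<Omega> T R" by (simp add: unique_minimizer_def)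
  let ?h = "H10_norm (cylinder \<Omega> \<tau> T) (\<lambda>z. vs z - vmin z)"
  let ?S = "K\<^sup>2 * measure lborel (QT \<Omega> T) + 2 * C2 * R\<^sup>2"
  have "C2 * ?h\<^sup>2 + ?\<alpha> / 2 * (sobolev_norm k (QT \<Omega> T) (\<lambda>z. vs z - vmin z))\<^sup>2
      \<le> J vs - J vmin - sobolev_inner k (QT \<Omega> T) (frechet_grad k \<Omega> T J vmin) (\<lambda>z. vs z - vmin z)"
    using *[OF mem] vs(2) by blast
  moreover have "0 \<le> sobolev_inner k (QT \<Omega> T) (frechet_grad k \<Omega> T J vmin) (\<lambda>z. vs z - vmin z)"
    by (rule minimizer_variational_inequality[OF \<Omega> min vs(2) grad[OF mem]])
  moreover have "0 \<le> J vmin" unfolding J using \<alpha>(1) by (intro tikhonov_nonneg) simp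
  moreover have "0 \<le> ?\<alpha> / 2 * (sobolev_norm k (QT \<Omega> T) (\<lambda>z. vs z - vmin z))\<^sup>2"
    using \<alpha>(1) by simp
  ultimately have "C2 * ?h\<^sup>2 \<le> J vs" by linarith
  also have "\<dots> \<le> ?e\<^sup>2 * (K\<^sup>2 * measure lborel (QT \<Omega> T)) + ?\<alpha> * (sobolev_norm k (QT \<Omega> T) vs)\<^sup>2"
    unfolding J using \<nu>3
    by (intro tikhonov_exact_solution_bound[OF \<Omega> T \<tau> a F g noise \<delta> vs(1) _ K]) simp
  also have "\<dots> \<le> ?e\<^sup>2 * (K\<^sup>2 * measure lborel (QT \<Omega> T)) + ?\<alpha> * R\<^sup>2"
  proof -
    interpret semi_inner_product "H0 k \<Omega> T" "sobolev_inner k (QT \<Omega> T)"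
      by (rule H0_semi_inner_product[OF \<Omega>])
    have "0 \<le> sobolev_norm k (QT \<Omega> T) vs"
      using nrm_nonneg[of vs] by (simp add: nrm_def sobolev_norm_def)
    then show ?thesis
      using vs(2) \<alpha>(1) by (intro add_left_mono mult_left_mono power_mono) (auto simp: B_closed_def)
  qed
  also have "\<dots> = ?e\<^sup>2 * ?S"
    unfolding alpha_of_def exp_powr_nu_of(1)[OF T \<delta> \<tau>] by (simp add: algebra_simps)
  finally have "?h\<^sup>2 \<le> ?e\<^sup>2 * (?S / C2)"
    using C2 by (simp add: field_simps)
  then have "\<bar>?h\<bar> \<le> sqrt (?e\<^sup>2 * (?S / C2))"
    using real_sqrt_le_mono by fastforce
  also have "\<dots> = sqrt (?S / C2) * ?e"
    by (simp only: real_sqrt_mult real_sqrt_abs) (simp add: error_rate_def)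
  finally show "?h \<le> sqrt (?S / C2) * ?e" by simp
qed

theorem theorem5p4:
  fixes \<Omega> :: "(real^'n::finite) set"
    and T \<mu>1 \<mu>2 M N R Cbar \<nu>3 C2 :: real
    and k :: nat
  assumes domain: "bounded_domain \<Omega>"
    and T: "T > 0"
    and k: "k > (CARD('n) + 1) div 2 + 2"
    and mu: "0 < \<mu>1" "\<mu>1 \<le> \<mu>2"
    and R: "R > 0"
    and Cbar: "Cbar > 0"
    and numbers: "\<nu>3 > 1" "C2 > 0"
  shows "\<exists>Ct>0. \<forall>\<tau>\<in>{0<..<T}.
    \<forall>(a :: 'n \<Rightarrow> 'n \<Rightarrow> (real^'n) \<times> real \<Rightarrow> real)
     (F :: (real^'n) \<times> real \<times> (real^'n) \<times> real \<Rightarrow> real)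
     (gs :: real^'n \<Rightarrow> real) (vs :: (real^'n) \<times> real \<Rightarrow> real)
     (g :: real^'n \<Rightarrow> real) (\<delta>0 :: real) (\<delta> :: real).
      coefficients \<Omega> T \<mu>1 \<mu>2 M a \<and> nonlinearity Cbar F \<and>
      terminal_data \<Omega> gs \<and> C_norm 2 \<Omega> gs = N \<and>
      exact_solution \<Omega> T a F gs vs \<and> vs \<in> B_open k \<Omega> T R \<and>
      \<delta>0 \<in> {0<..<1} \<and> nu_of T \<delta>0 \<ge> \<nu>3 \<and>
      2 * C2 * exp (- 2 * (\<tau> + 1) powr nu_of T \<delta>0) \<in> {0<..<1} \<and>
      \<delta> \<in> {0<..<\<delta>0} \<and>
      terminal_data \<Omega> g \<and> C_norm 2 \<Omega> (\<lambda>x. g x - gs x) < \<delta> \<and>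
      strict_convexity_property k \<Omega> T \<tau> R a F g \<nu>3 C2 \<longrightarrow>
      (let \<nu> = nu_of T \<delta>;
           \<alpha> = alpha_of T \<tau> C2 \<delta>;
           J = tikhonov k \<Omega> T \<tau> a F g \<alpha> \<nu>;
           c = rate_exponent \<tau> T
       in c \<in> {0<..<1} \<and>
          (\<forall>vmin. unique_minimizer J (B_closed k \<Omega> T R) vmin \<longrightarrow>
             H10_norm (cylinder \<Omega> \<tau> T) (\<lambda>z. vs z - vmin z) \<le> Ct * error_rate c \<delta> \<and>
             (\<forall>\<gamma>0 \<gamma> \<theta> v0.
                \<gamma>0 \<in> {0<..<1} \<and> gradient_projection_property k \<Omega> T R J vmin \<gamma>0 \<and>
                \<gamma> \<in> {0<..<\<gamma>0} \<and> \<theta> \<in> {0<..<1} \<and> converges_at_rate k \<Omega> T R J vmin \<gamma> \<theta> \<and>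
                v0 \<in> B_open k \<Omega> T R \<longrightarrow>
                (\<forall>m\<ge>1.
                   H10_norm (cylinder \<Omega> \<tau> T) (\<lambda>z. vs z - gradient_projection k \<Omega> T R J \<gamma> v0 m z)
                   \<le> Ct * error_rate c \<delta>
                      + \<theta> ^ m * sobolev_norm k (QT \<Omega> T) (\<lambda>z. vmin z - v0 z)))))"
proof -
  have \<Omega>: "open \<Omega>" "bounded \<Omega>"
    using domain by (auto simp: bounded_domain_def)
  define K where "K = (real CARD('n))\<^sup>2 * \<bar>M\<bar> + Cbar * (real CARD('n) + 1)"
  define Ct where "Ct = sqrt ((K\<^sup>2 * measure lborel (QT \<Omega> T) + 2 * C2 * R\<^sup>2) / C2)"
  show ?thesis
  proof (intro exI[of _ Ct] conjI[of "0 < Ct"] ballI allI impI, goal_cases)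
    case 1
    have "0 \<le> K\<^sup>2 * measure lborel (QT \<Omega> T)" "0 < 2 * C2 * R\<^sup>2"
      using R numbers by auto
    then show ?case
      unfolding Ct_def using numbers by (simp add: add_nonneg_pos)
  next
    case (2 \<tau> a F gs vs g \<delta>0 \<delta>)
    then have \<tau>: "0 < \<tau>" "\<tau> < T"
      and a: "coefficients \<Omega> T \<mu>1 \<mu>2 M a" and F: "nonlinearity Cbar F"
      and g: "C_closed 2 \<Omega> gs" "C_closed 2 \<Omega> g"
      and vs: "exact_solution \<Omega> T a F gs vs" "vs \<in> B_closed k \<Omega> T R"
      and \<delta>0: "\<delta>0 < 1" "\<nu>3 \<le> nu_of T \<delta>0" and \<delta>: "0 < \<delta>" "\<delta> < \<delta>0"
      and noise: "C_norm 2 \<Omega> (\<lambda>x. g x - gs x) \<le> \<delta>"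
      and conv: "strict_convexity_property k \<Omega> T \<tau> R a F g \<nu>3 C2"
      using B_open_subset_B_closed[of k \<Omega> T R] by (auto simp: terminal_data_def)
    have \<delta>1: "\<delta> < 1" using \<delta> \<delta>0 by simp
    have \<nu>3: "0 \<le> \<nu>3" "\<nu>3 \<le> nu_of T \<delta>"
      using numbers \<delta>0 nu_of_antimono[OF T \<delta>(1) less_imp_le[OF \<delta>(2)] \<delta>0(1)] by auto
    define J where "J = tikhonov k \<Omega> T \<tau> a F g (alpha_of T \<tau> C2 \<delta>) (nu_of T \<delta>)"
    note error = minimizer_error_estimate[OF \<Omega> T \<tau>(1) R numbers(2) a F g noise \<delta>(1) \<delta>1 vs \<nu>3 conv
        J_def K_def, folded Ct_def]
    show ?case
      unfolding Let_def J_def[symmetric]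
    proof (intro conjI allI impI, goal_cases)
      case 1
      show ?case by (rule rate_exponent_bounds[OF \<tau>])
    next
      case (2 vmin)
      then show ?case by (rule error(2))
    next
      case (3 vmin \<gamma>0 \<gamma> \<theta> v0 m)
      let ?v = "gradient_projection k \<Omega> T R J \<gamma> v0 m"
      have k1: "1 \<le> k" using k by simp
      have \<tau>0: "0 \<le> \<tau>" using \<tau> by simp
      have v0: "v0 \<in> B_closed k \<Omega> T R" "v0 \<in> B_open k \<Omega> T R"
        using 3(2) B_open_subset_B_closed[of k \<Omega> T R] by auto
      have "?v \<in> B_closed k \<Omega> T R"
        using R v0(1) error(1) by (intro gradient_projection_mem \<Omega>) (auto simp: is_frechet_grad_def)
      then have mem: "?v \<in> H0 k \<Omega> T" "vs \<in> H0 k \<Omega> T" "vmin \<in> H0 k \<Omega> T"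
        using vs(2) 3(1) by (auto simp: B_closed_def unique_minimizer_def)
      interpret semi_inner_product "H0 k \<Omega> T" "sobolev_inner k (QT \<Omega> T)"
        by (rule H0_semi_inner_product[OF \<Omega>])
      have "H10_norm (cylinder \<Omega> \<tau> T) (\<lambda>z. vs z - ?v z)
          \<le> H10_norm (cylinder \<Omega> \<tau> T) (\<lambda>z. vs z - vmin z) + H10_norm (cylinder \<Omega> \<tau> T) (\<lambda>z. vmin z - ?v z)"
        by (rule H10_norm_diff_triangle[OF \<Omega> \<tau>0 k1 mem(2,3,1)])
      also have "\<dots> \<le> Ct * error_rate (rate_exponent \<tau> T) \<delta> + sobolev_norm k (QT \<Omega> T) (\<lambda>z. vmin z - ?v z)"
        by (intro add_mono error(2) 3(1) H10_norm_le_sobolev_norm \<Omega> \<tau>0 k1 diff_mem mem)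
      also have "sobolev_norm k (QT \<Omega> T) (\<lambda>z. vmin z - ?v z) = sobolev_norm k (QT \<Omega> T) (\<lambda>z. ?v z - vmin z)"
        using nrm_diff_commute[OF mem(3,1)] by (simp add: nrm_def sobolev_norm_def)
      also have "\<dots> \<le> \<theta> ^ m * sobolev_norm k (QT \<Omega> T) (\<lambda>z. vmin z - v0 z)"
        using 3(2,3) v0(2) unfolding converges_at_rate_def by blast
      finally show ?case by simp
    qed
  qed
qed

end
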